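(* Assume that for every integer $n\ge1$ and every real transcendental $\zeta$ there exist infinitely many $k$ such that the $n+1$ consecutive best approximation polynomials $P_k,P_{k+1},\dots,P_{k+n}$ for $(n,\zeta)$ are linearly independent, i.e. their coefficient vectors span $\mathbb R^{n+1}$. Then for every $\epsilon>0$ there exists $n_0=n_0(\epsilon)$ such that for every real transcendental $\zeta$ and every $n\ge n_0$, $$\widehat w_n(\zeta)\le 2n-1-\log 2+\epsilon .$$
   Context: For $P\in\mathbb Z[X]$, $H(P)$ denotes the maximum absolute value of its coefficients. A best approximation for $(n,\zeta)$ is a nonzero $P\in\mathbb Z[X]$ of degree at most $n$ such that every nonzero $Q\in\mathbb Z[X]$ of degree at most $n$ with $H(Q)<H(P)$ satisfies $|Q(\zeta)|>|P(\zeta)|$. For transcendental $\zeta$ these form, up to sign, a sequence $P_1,P_2,\dots$ with $H(P_1)\le H(P_2)\le\cdots$ and $|P_1(\zeta)|>|P_2(\zeta)|>\cdots$. $\widehat w_n(\zeta)$ is the supremum of $\nu$ such that, for all sufficiently large $X$, there is a nonzero $P\in\mathbb Z[X]$ with $\deg P\le n$, $H(P)\le X$ and $|P(\zeta)|\le X^{-\nu}$. *)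

theory Defs
  imports "HOL-Analysis.Analysis" "HOL-Computational_Algebra.Polynomial"
begin

definition ipoly :: "int poly \<Rightarrow> real \<Rightarrow> real" where
  "ipoly P x = poly (map_poly real_of_int P) x"

definition height :: "int poly \<Rightarrow> int" where
  "height P = Max ((\<lambda>i. \<bar>coeff P i\<bar>) ` {..degree P})"

definition best_approx :: "nat \<Rightarrow> real \<Rightarrow> int poly \<Rightarrow> bool" where
  "best_approx n \<zeta> P \<longleftrightarrow> P \<noteq> 0 \<and> degree P \<le> n \<and>
     (\<forall>Q. Q \<noteq> 0 \<and> degree Q \<le> n \<and> height Q < height P
          \<longrightarrow> \<bar>ipoly Q \<zeta>\<bar> > \<bar>ipoly P \<zeta>\<bar>)"

definition best_approx_seq :: "nat \<Rightarrow> real \<Rightarrow> (nat \<Rightarrow> int poly) \<Rightarrow> bool" where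
  "best_approx_seq n \<zeta> P \<longleftrightarrow>
     (\<forall>k. best_approx n \<zeta> (P k)) \<and>
     (\<forall>k. \<bar>ipoly (P (Suc k)) \<zeta>\<bar> < \<bar>ipoly (P k) \<zeta>\<bar>) \<and>
     (\<forall>Q. best_approx n \<zeta> Q \<longrightarrow> (\<exists>k. Q = P k \<or> Q = - P k))"

definition consec_lin_indep :: "nat \<Rightarrow> (nat \<Rightarrow> int poly) \<Rightarrow> nat \<Rightarrow> bool" where
  "consec_lin_indep n P k \<longleftrightarrow>
     (\<forall>c :: nat \<Rightarrow> real.
        (\<forall>j\<le>n. (\<Sum>i\<le>n. c i * real_of_int (coeff (P (k + i)) j)) = 0)
        \<longrightarrow> (\<forall>i\<le>n. c i = 0))"

definition hat_w :: "nat \<Rightarrow> real \<Rightarrow> ereal" where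
  "hat_w n \<zeta> = Sup {ereal \<nu> | \<nu>. eventually (\<lambda>X::real. \<exists>P::int poly.
       P \<noteq> 0 \<and> degree P \<le> n \<and> real_of_int (height P) \<le> X \<and>
       \<bar>ipoly P \<zeta>\<bar> \<le> X powr (- \<nu>)) at_top}"

end

theory Submission
  imports Defs "Jordan_Normal_Form.Determinant" "HOL-Computational_Algebra.Polynomial_Factorial"
begin

text \<open>
  Suppose that \<open>\<zeta>\<close> is approximated uniformly with exponent \<open>\<nu> = 2 n - 7 / 4\<close>, so that best
  approximations satisfy \<open>\<bar>P\<^sub>k(\<zeta>)\<bar> \<le> H(P\<^sub>k\<^sub>+\<^sub>1) powr (- \<nu>)\<close>. The determinant of \<open>n + 1\<close> independent
  consecutive ones is a nonzero integer, whence \<open>1 \<lless> \<bar>P\<^sub>k(\<zeta>)\<bar> H(P\<^sub>k\<^sub>+\<^sub>1) \<cdots> H(P\<^sub>k\<^sub>+\<^sub>n)\<close>; this forces a jump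
  \<open>H(P\<^sub>j\<^sub>+\<^sub>1) > H(P\<^sub>j) powr (1 + 1 / n)\<close>, and so infinitely many \<open>P\<close> with \<open>\<bar>P(\<zeta>)\<bar> \<le> H(P) powr (- w)\<close> for a
  fixed \<open>w > 2 n\<close>. Since heights are multiplicative up to constants, there are infinitely many
  irreducible \<open>Q\<close> with \<open>\<bar>Q(\<zeta>)\<bar> \<le> H(Q) powr (- 2 n)\<close>. For a suitable size \<open>X\<close>, the polynomial \<open>R\<close> of
  height at most \<open>X\<close> with \<open>\<bar>R(\<zeta>)\<bar> \<le> X powr (- \<nu>)\<close> is then not divisible by \<open>Q\<close>, but the resultant of
  \<open>Q\<close> and \<open>R\<close> has absolute value less than one. The argument works for all \<open>n \<ge> 10\<close>, and
  \<open>2 n - 7 / 4 \<le> 2 n - 1 - ln 2\<close>.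
\<close>

hide_const (open) Determinants.det Module.smult

section \<open>Evaluation and height of integer polynomials\<close>

lemma ipoly_0 [simp]: "ipoly 0 x = 0"
  by (simp add: ipoly_def)

lemma ipoly_pCons [simp]: "ipoly (pCons a P) x = of_int a + x * ipoly P x"
  by (simp add: ipoly_def map_poly_pCons)

lemma ipoly_add [simp]: "ipoly (P + Q) x = ipoly P x + ipoly Q x"
  by (induction P Q rule: poly_induct2) (auto simp: algebra_simps)

lemma ipoly_minus [simp]: "ipoly (- P) x = - ipoly P x"
  by (induction P) auto

lemma ipoly_diff [simp]: "ipoly (P - Q) x = ipoly P x - ipoly Q x"
  using ipoly_add[of P "- Q" x] by simp

lemma ipoly_smult [simp]: "ipoly (smult a P) x = of_int a * ipoly P x"
  by (induction P) (auto simp: algebra_simps)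

lemma ipoly_mult [simp]: "ipoly (P * Q) x = ipoly P x * ipoly Q x"
  by (induction P) (auto simp: algebra_simps)

lemma ipoly_monom [simp]: "ipoly (monom a i) x = of_int a * x ^ i"
  by (simp add: ipoly_def map_poly_monom poly_monom)

lemma ipoly_altdef:
  assumes "degree P < D"
  shows "ipoly P x = (\<Sum>i<D. of_int (coeff P i) * x ^ i)"
  using assms unfolding ipoly_def poly_altdef
  by (intro sum.mono_neutral_cong_left) (auto simp: coeff_map_poly degree_map_poly coeff_eq_0)

lemma ipoly_eq_0_iff:
  assumes "\<not> algebraic \<zeta>"
  shows "ipoly P \<zeta> = 0 \<longleftrightarrow> P = 0"
proof
  assume *: "ipoly P \<zeta> = 0"
  show "P = 0"
  proof (rule ccontr)
    assume "P \<noteq> 0"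
    then have "map_poly real_of_int P \<noteq> 0"
      by (metis coeff_0 coeff_map_poly leading_coeff_0_iff of_int_0 of_int_eq_0_iff)
    with * have "algebraic \<zeta>"
      by (intro algebraicI[of "map_poly real_of_int P"]) (auto simp: ipoly_def coeff_map_poly)
    with assms show False by simp
  qed
qed simp

lemma abs_coeff_le_height: "\<bar>coeff P i\<bar> \<le> height P"
proof (cases "i \<le> degree P")
  case True
  then show ?thesis by (auto simp: height_def intro: Max_ge)
next
  case False
  then have "coeff P i = 0" by (simp add: coeff_eq_0)
  also have "\<bar>0\<bar> \<le> \<bar>coeff P 0\<bar>" by simp
  also have "\<dots> \<le> height P" by (auto simp: height_def intro: Max_ge)
  finally show ?thesis by simp
qed

lemma height_leI: "(\<And>i. \<bar>coeff P i\<bar> \<le> B) \<Longrightarrow> height P \<le> B"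
  by (auto simp: height_def)

lemma height_nonneg: "height P \<ge> 0"
  using abs_coeff_le_height[of P 0] by linarith

lemma height_ge_1:
  assumes "P \<noteq> 0"
  shows "height P \<ge> 1"
proof -
  have "1 \<le> \<bar>lead_coeff P\<bar>" using assms leading_coeff_0_iff[of P] by linarith
  with abs_coeff_le_height[of P "degree P"] show ?thesis by linarith
qed

lemma height_minus [simp]: "height (- P) = height P"
  by (simp add: height_def)

lemma height_const [simp]: "height [:a:] = \<bar>a\<bar>"
  by (simp add: height_def)

lemma height_smult_ge:
  assumes "a \<noteq> 0"
  shows "height P \<le> height (smult a P)"
proof (rule height_leI)
  fix i
  have "\<bar>coeff P i\<bar> \<le> \<bar>a\<bar> * \<bar>coeff P i\<bar>"
    using assms by (simp add: mult_le_cancel_right1) linarith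
  also have "\<dots> \<le> height (smult a P)"
    using abs_coeff_le_height[of "smult a P" i] by (simp add: abs_mult)
  finally show "\<bar>coeff P i\<bar> \<le> height (smult a P)" .
qed

lemma height_monom_mult_le: "height (monom 1 i * P) \<le> height P"
  by (rule height_leI) (auto simp: coeff_monom_mult abs_coeff_le_height height_nonneg)

text \<open>This finiteness makes the heights of distinct best approximations unbounded and leaves
  only finitely many polynomials of small height to absorb into a constant.\<close>

lemma finite_bounded_height: "finite {P. degree P \<le> n \<and> height P \<le> B}"
proof (rule finite_subset)
  let ?L = "{xs. set xs \<subseteq> {-B..B} \<and> length xs \<le> Suc n}"
  show "finite (Poly ` ?L)"
    by (intro finite_imageI finite_lists_length_le) simp
  show "{P. degree P \<le> n \<and> height P \<le> B} \<subseteq> Poly ` ?L"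
  proof
    fix P assume P: "P \<in> {P. degree P \<le> n \<and> height P \<le> B}"
    have "coeff P i \<in> {-B..B}" for i
      using abs_coeff_le_height[of P i] P by (auto simp: abs_le_iff)
    then have "set (coeffs P) \<subseteq> {-B..B}"
      using range_coeff[of P] by (metis image_subsetI insertCI subset_iff)
    moreover have "length (coeffs P) \<le> Suc n"
      using P by (cases "P = 0") (auto simp: length_coeffs_degree)
    ultimately show "P \<in> Poly ` ?L"
      by (intro image_eqI[of _ _ "coeffs P"]) auto
  qed
qed

section \<open>Determinant and resultant bounds\<close>

text \<open>Multiplying by \<open>V\<close> replaces column \<open>0\<close> of the coefficient matrix by the values at \<open>\<zeta>\<close>
  without changing the determinant.\<close>

lemma det_height_bound:
  fixes F :: "nat \<Rightarrow> int poly" and \<zeta> E :: real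
  assumes D: "D > 0"
    and deg: "\<And>i. i < D \<Longrightarrow> degree (F i) < D"
    and nz: "\<And>i. i < D \<Longrightarrow> F i \<noteq> 0"
    and indep: "\<And>c. (\<Sum>i<D. smult (c i) (F i)) = 0 \<Longrightarrow> \<forall>i<D. c i = 0"
    and E: "\<And>i. i < D \<Longrightarrow> \<bar>ipoly (F i) \<zeta>\<bar> * (\<Prod>j<D. of_int (height (F j))) \<le> E * of_int (height (F i))"
  shows "1 \<le> fact D * E"
proof -
  define M :: "int mat" where "M = mat D D (\<lambda>(i,j). coeff (F j) i)"
  define N :: "real mat" where "N = mat D D (\<lambda>(i,j). of_int (coeff (F i) j))"
  define V :: "real mat" where
    "V = mat D D (\<lambda>(i,j). if j = 0 then \<zeta> ^ i else if i = j then 1 else 0)"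
  have car: "M \<in> carrier_mat D D" "N \<in> carrier_mat D D" "V \<in> carrier_mat D D"
    by (auto simp: M_def N_def V_def)
  \<comment> \<open>The columns of \<open>M\<close> are coefficient vectors, so an integer kernel
    vector would be an integer relation between the \<open>F i\<close>.\<close>
  have "Determinant.det M \<noteq> 0"
  proof
    assume "Determinant.det M = 0"
    then obtain v where v: "v \<in> carrier_vec D" "v \<noteq> 0\<^sub>v D" "M *\<^sub>v v = 0\<^sub>v D"
      using det_0_iff_vec_prod_zero[OF car(1)] by auto
    have "(\<Sum>i<D. smult (vec_index v i) (F i)) = 0"
    proof (rule poly_eqI)
      fix j
      show "coeff (\<Sum>i<D. smult (vec_index v i) (F i)) j = coeff 0 j"
      proof (cases "j < D")
        case True
        have "vec_index (M *\<^sub>v v) j = (\<Sum>i<D. coeff (F i) j * vec_index v i)"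
          using True v(1) unfolding M_def
          by (auto simp: scalar_prod_def atLeast0LessThan intro!: sum.cong)
        with v(3) True show ?thesis by (simp add: coeff_sum mult.commute)
      next
        case False
        then show ?thesis
          using deg by (auto simp: coeff_sum intro!: sum.neutral coeff_eq_0) fastforce
      qed
    qed
    from indep[OF this] v(1,2) show False by auto
  qed
  then have "1 \<le> \<bar>real_of_int (Determinant.det M)\<bar>" by linarith
  also have "real_of_int (Determinant.det M) = Determinant.det (map_mat of_int M)"
    by (simp add: of_int_hom.hom_det)
  also have "map_mat of_int M = transpose_mat N"
    by (rule eq_matI) (auto simp: M_def N_def)
  also have "Determinant.det (transpose_mat N) = Determinant.det N"
    by (rule det_transpose[OF car(2)])
  also have "Determinant.det N = Determinant.det (N * V)"
  proof -
    have "Determinant.det V = prod_list (diag_mat V)"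
      by (rule det_lower_triangular[OF _ car(3)]) (auto simp: V_def)
    also have "\<dots> = 1"
      by (auto simp: prod_list_diag_prod V_def intro!: prod.neutral)
    finally show ?thesis using det_mult[OF car(2,3)] by simp
  qed
  also have "\<bar>Determinant.det (N * V)\<bar> \<le> fact D * E"
  proof -
    have entry0: "(N * V) $$ (i, 0) = ipoly (F i) \<zeta>" if "i < D" for i
      using that D deg[OF that] unfolding N_def V_def
      by (auto simp: scalar_prod_def ipoly_altdef atLeast0LessThan intro!: sum.cong)
    have entry: "(N * V) $$ (i, j) = of_int (coeff (F i) j)" if "i < D" "j < D" "j \<noteq> 0" for i j
      using that unfolding N_def V_def
      by (simp add: scalar_prod_def atLeast0LessThan if_distrib[of "(*) (real_of_int a)" for a] cong: if_cong)
    \<comment> \<open>A permutation meets the column of values in exactly one row \<open>i\<close>;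
      every other row contributes at most its height. The resulting product is what hypothesis
      \<open>E\<close> controls.\<close>
    have "\<bar>\<Prod>i = 0..<D. (N * V) $$ (i, p i)\<bar> \<le> E" if p: "p permutes {0..<D}" for p
    proof -
      obtain i where i: "i < D" "p i = 0"
        using p D by (metis atLeastLessThan_iff permutes_def zero_le)
      have other: "p j \<noteq> 0" if "j \<noteq> i" for j
        using p i that by (metis permutes_def)
      let ?h = "\<lambda>j. real_of_int (height (F j))"
      have hi: "?h i > 0" using height_ge_1[OF nz[OF i(1)]] by linarith
      have split: "{0..<D} = insert i ({..<D} - {i})" "{..<D} = insert i ({..<D} - {i})"
        using i by auto
      have "\<bar>\<Prod>j = 0..<D. (N * V) $$ (j, p j)\<bar>
          = \<bar>ipoly (F i) \<zeta>\<bar> * (\<Prod>j\<in>{..<D} - {i}. \<bar>(N * V) $$ (j, p j)\<bar>)"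
        unfolding split(1) by (subst prod.insert) (simp_all add: entry0 i abs_mult abs_prod)
      also have "\<dots> \<le> \<bar>ipoly (F i) \<zeta>\<bar> * (\<Prod>j\<in>{..<D} - {i}. ?h j)"
      proof (intro mult_left_mono prod_mono conjI)
        fix j assume j: "j \<in> {..<D} - {i}"
        have "p j < D" using p j by (metis DiffD1 atLeastLessThan_iff lessThan_iff permutes_in_image zero_le)
        with j other[of j] show "\<bar>(N * V) $$ (j, p j)\<bar> \<le> ?h j"
          using abs_coeff_le_height[of "F j" "p j"] by (simp add: entry flip: of_int_abs)
      qed auto
      also have "\<dots> = \<bar>ipoly (F i) \<zeta>\<bar> * (\<Prod>j<D. ?h j) / ?h i"
        using hi i(1) by (simp add: prod.remove[of "{..<D}" i])
      also have "\<dots> \<le> E"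
        using E[OF i(1)] hi by (simp add: field_simps)
      finally show ?thesis .
    qed
    then have "\<bar>\<Sum>p | p permutes {0..<D}. signof p * (\<Prod>i = 0..<D. (N * V) $$ (i, p i))\<bar>
        \<le> (\<Sum>p | p permutes {0..<D}. E)"
      by (intro order.trans[OF sum_abs] sum_mono) (auto simp: abs_mult sign_def)
    also have "\<dots> = fact D * E"
      using card_permutations[of "{0..<D}" D] by simp
    finally show ?thesis
      using det_def'[of "N * V" D] car by simp
  qed
  finally show ?thesis .
qed

text \<open>The shifts \<open>X^i Q\<close> for \<open>i < n\<close> and \<open>X^i R\<close> for
  \<open>i < m\<close> are the rows of a Sylvester matrix in which \<open>R\<close> has formal
  degree \<open>n\<close>. They are independent because \<open>S * Q + T * R = 0\<close> forces the
  prime \<open>Q\<close> to divide \<open>T\<close>, whose degree would be below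
  \<open>m = degree Q\<close>.\<close>

lemma resultant_height_bound:
  fixes Q R :: "int poly" and \<zeta> :: real
  assumes Q: "prime_elem Q" "degree Q = m" "m > 0"
    and R: "\<not> Q dvd R" "degree R \<le> n" and n: "n > 0"
  shows "1 \<le> fact (n + m) * (max 1 \<bar>\<zeta>\<bar>) ^ (n + m) *
     (\<bar>ipoly Q \<zeta>\<bar> * of_int (height Q) ^ (n - 1) * of_int (height R) ^ m
    + \<bar>ipoly R \<zeta>\<bar> * of_int (height Q) ^ n * of_int (height R) ^ (m - 1))"
proof -
  define F where "F i = (if i < n then monom 1 i * Q else monom 1 (i - n) * R)" for i
  define Z where "Z = max 1 \<bar>\<zeta>\<bar> ^ (n + m)"
  define q r where "q = real_of_int (height Q)" and "r = real_of_int (height R)"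
  have nz: "Q \<noteq> 0" "R \<noteq> 0" using Q(3) Q(2) R(1) by auto
  have hmono: "height (monom 1 i * P) = height P" for i and P :: "int poly"
  proof (rule antisym[OF height_monom_mult_le], rule height_leI)
    fix j show "\<bar>coeff P j\<bar> \<le> height (monom 1 i * P)"
      using abs_coeff_le_height[of "monom 1 i * P" "j + i"] by (simp add: coeff_monom_mult)
  qed
  have pos: "q > 0" "r > 0"
    using height_ge_1[OF nz(1)] height_ge_1[OF nz(2)] by (auto simp: q_def r_def)
  have hF: "real_of_int (height (F i)) = (if i < n then q else r)" for i
    by (simp add: F_def hmono q_def r_def)
  have *: "{..<n + m} \<inter> {n..} = {n..<n + m}" by auto
  have prod: "(\<Prod>j<n + m. real_of_int (height (F j))) = q ^ n * r ^ m"
    unfolding hF 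
    by (simp add: prod.If_cases Int_absorb1 * lessThan_def [symmetric])
  have pw: "\<bar>\<zeta>\<bar> ^ i \<le> Z" if "i \<le> n + m" for i
  proof -
    have "\<bar>\<zeta>\<bar> ^ i \<le> max 1 \<bar>\<zeta>\<bar> ^ i" by (intro power_mono) auto
    also have "\<dots> \<le> Z" unfolding Z_def using that by (intro power_increasing) auto
    finally show ?thesis .
  qed
  have "1 \<le> fact (n + m) * (Z * (\<bar>ipoly Q \<zeta>\<bar> * q ^ (n - 1) * r ^ m + \<bar>ipoly R \<zeta>\<bar> * q ^ n * r ^ (m - 1)))"
  proof (rule det_height_bound[where F = F])
    show "n + m > 0" using n by simp
    show "degree (F i) < n + m" if "i < n + m" for i
      using that nz Q R by (auto simp: F_def degree_mult_eq degree_monom_eq)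
    show "F i \<noteq> 0" if "i < n + m" for i using nz by (auto simp: F_def)
  next
    fix c assume c: "(\<Sum>i<n + m. smult (c i) (F i)) = 0"
    define S T where "S = (\<Sum>i<n. monom (c i) i)" and "T = (\<Sum>i<m. monom (c (n + i)) i)"
    have "(\<Sum>i<n + m. smult (c i) (F i)) = (\<Sum>i<n. smult (c i) (F i)) + (\<Sum>i<m. smult (c (n + i)) (F (n + i)))"
      using sum.atLeastLessThan_concat[of 0 n "n + m" "\<lambda>i. smult (c i) (F i)"]
        sum.shift_bounds_nat_ivl[of "\<lambda>i. smult (c i) (F i)" 0 n m]
      by (simp add: atLeast0LessThan add.commute)
    also have "\<dots> = S * Q + T * R"
      by (simp add: S_def T_def F_def sum_distrib_right smult_monom flip: mult_smult_left)
    finally have eq: "S * Q + T * R = 0" using c by simp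
    have coS: "coeff S i = (if i < n then c i else 0)" for i
      by (auto simp: S_def coeff_sum)
    have coT: "coeff T i = (if i < m then c (n + i) else 0)" for i
      by (auto simp: T_def coeff_sum)
    have "T * R = Q * (- S)" using eq by (simp add: algebra_simps add_eq_0_iff)
    then have "Q dvd T * R" by (rule dvdI)
    with Q(1) R(1) have "Q dvd T" by (simp add: prime_elem_dvd_mult_iff)
    have "T = 0"
    proof (rule ccontr)
      assume "T \<noteq> 0"
      with \<open>Q dvd T\<close> have "m \<le> degree T" using Q(2) dvd_imp_degree_le by blast
      then have "coeff T (degree T) = 0" unfolding coT by simp
      with \<open>T \<noteq> 0\<close> show False by simp
    qed
    with eq nz have "S = 0" by simp
    show "\<forall>i<n + m. c i = 0"
    proof (intro allI impI)
      fix i assume "i < n + m"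
      then show "c i = 0"
        using coS[of i] coT[of "i - n"] \<open>S = 0\<close> \<open>T = 0\<close> by (cases "i < n") (auto simp: not_less split: if_splits)
    qed
  next
    fix i assume i: "i < n + m"
    \<comment> \<open>\<open>?A\<close> and \<open>?B\<close> are the value of \<open>Q\<close> or
      \<open>R\<close> at \<zeta> times the heights of all other rows; \<open>Z\<close> absorbs the
      powers of \<zeta> that come from the shifts.\<close>
    let ?A = "\<bar>ipoly Q \<zeta>\<bar> * q ^ (n - 1) * r ^ m" and ?B = "\<bar>ipoly R \<zeta>\<bar> * q ^ n * r ^ (m - 1)"
    have AB: "?A \<ge> 0" "?B \<ge> 0" "Z \<ge> 0" using pos by (auto simp: Z_def)
    show "\<bar>ipoly (F i) \<zeta>\<bar> * (\<Prod>j<n + m. real_of_int (height (F j)))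
        \<le> Z * (?A + ?B) * real_of_int (height (F i))"
    proof (cases "i < n")
      case True
      have "\<bar>ipoly (F i) \<zeta>\<bar> * (q ^ n * r ^ m) = \<bar>\<zeta>\<bar> ^ i * (?A * q)"
        using True power_minus_mult[OF n, of q] by (simp add: F_def abs_mult power_abs)
      also have "\<dots> \<le> Z * ((?A + ?B) * q)"
        using AB pos pw[of i] i by (intro mult_mono) auto
      finally show ?thesis unfolding prod using True by (simp add: hF mult.assoc)
    next
      case False
      have "\<bar>ipoly (F i) \<zeta>\<bar> * (q ^ n * r ^ m) = \<bar>\<zeta>\<bar> ^ (i - n) * (?B * r)"
        using False power_minus_mult[OF Q(3), of r] by (simp add: F_def abs_mult power_abs)
      also have "\<dots> \<le> Z * ((?A + ?B) * r)"
        using AB pos pw[of "i - n"] i by (intro mult_mono) auto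
      finally show ?thesis unfolding prod using False by (simp add: hF mult.assoc)
    qed
  qed
  then show ?thesis by (simp add: Z_def q_def r_def mult.assoc)
qed

section \<open>Heights of products\<close>

text \<open>Quantitative interpolation, by splitting off one node \<open>s\<close> at a time through
  division by \<open>X - s\<close>. Distinct integer nodes are at distance at least 1, so the
  quotient has values at most \<open>2 * M\<close> at the remaining nodes. The degree condition is
  phrased by vanishing coefficients so that the empty node set forces the zero polynomial.\<close>

lemma coeff_bound_from_values:
  fixes S :: "int set"
  assumes "finite S"
  shows "\<exists>K\<ge>0. \<forall>P :: int poly. \<forall>M. (\<forall>i\<ge>card S. coeff P i = 0) \<longrightarrow> (\<forall>x\<in>S. \<bar>poly P x\<bar> \<le> M) \<longrightarrow>
    (\<forall>i. \<bar>coeff P i\<bar> \<le> K * M)"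
  using assms
proof (induction S)
  case empty
  show ?case by (intro exI[of _ 0]) auto
next
  case (insert s S)
  then obtain K where K: "K \<ge> 0" and IH: "\<And>P :: int poly. \<And>M i. \<lbrakk>\<forall>i\<ge>card S. coeff P i = 0; \<forall>x\<in>S. \<bar>poly P x\<bar> \<le> M\<rbrakk> \<Longrightarrow>
      \<bar>coeff P i\<bar> \<le> K * M"
    by metis
  show ?case
  \<comment> \<open>In \<open>P = (X - s) * Q + P(s)\<close> the coefficients of \<open>Q\<close>
    are at most \<open>2 * K * M\<close>; the factor \<open>X - s\<close> contributes
    \<open>1 + \<bar>s\<bar>\<close> and the remainder another \<open>M\<close>.\<close>
  proof (intro exI[of _ "1 + 2 * K * (1 + \<bar>s\<bar>)"] conjI allI impI)
    fix P :: "int poly" and M i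
    assume P0: "\<forall>i\<ge>card (insert s S). coeff P i = 0" and PM: "\<forall>x\<in>insert s S. \<bar>poly P x\<bar> \<le> M"
    define Q where "Q = synthetic_div P s"
    have P: "P = [:- s, 1:] * Q + [:poly P s:]"
      by (simp only: Q_def synthetic_div_correct')
    have M: "M \<ge> 0" "\<bar>poly P s\<bar> \<le> M" using PM by auto
    have "degree P \<le> card S"
      using P0 insert.hyps by (intro degree_le) auto
    have "coeff Q j = 0" if "j \<ge> card S" for j
    proof (cases "degree P = 0")
      case True
      then show ?thesis by (simp add: Q_def synthetic_div_eq_0_iff[THEN iffD2])
    next
      case False
      with \<open>degree P \<le> card S\<close> that show ?thesis
        by (intro coeff_eq_0) (simp add: Q_def degree_synthetic_div)
    qed
    moreover have "\<bar>poly Q x\<bar> \<le> 2 * M" if x: "x \<in> S" for x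
    proof -
      have "poly P x - poly P s = (x - s) * poly Q x"
        by (subst P) (simp add: algebra_simps)
      moreover have "x \<noteq> s" using x insert.hyps by auto
      then have "1 \<le> \<bar>x - s\<bar>" by linarith
      ultimately have "\<bar>poly Q x\<bar> \<le> \<bar>poly P x - poly P s\<bar>"
        by (simp add: abs_mult mult_le_cancel_right1)
      also have "\<dots> \<le> 2 * M" using PM x M by fastforce
      finally show ?thesis .
    qed
    ultimately have Q: "\<bar>coeff Q j\<bar> \<le> K * (2 * M)" for j
      using IH[of Q "2 * M" j] by blast
    have "coeff P i = coeff (pCons (poly P s) Q) i - s * coeff Q i"
      by (subst P) (simp add: coeff_pCons algebra_simps split: nat.splits)
    also have "\<bar>\<dots>\<bar> \<le> \<bar>coeff (pCons (poly P s) Q) i\<bar> + \<bar>s\<bar> * \<bar>coeff Q i\<bar>"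
      by (metis abs_mult abs_triangle_ineq4)
    also have "\<dots> \<le> (M + K * (2 * M)) + \<bar>s\<bar> * (K * (2 * M))"
    proof (intro add_mono mult_left_mono Q)
      have "0 \<le> K * (2 * M)" using K M by simp
      then show "\<bar>coeff (pCons (poly P s) Q) i\<bar> \<le> M + K * (2 * M)"
        using M Q[of "i - 1"] by (auto simp: coeff_pCons split: nat.splits)
    qed auto
    finally show "\<bar>coeff P i\<bar> \<le> (1 + 2 * K * (1 + \<bar>s\<bar>)) * M"
      by (simp add: algebra_simps)
  qed (use K in simp)
qed

lemma abs_poly_le_height:
  fixes P :: "int poly"
  assumes "degree P \<le> N"
  shows "\<bar>poly P x\<bar> \<le> (\<Sum>i\<le>N. \<bar>x\<bar> ^ i) * height P"
proof -
  have "poly P x = (\<Sum>i\<le>N. coeff P i * x ^ i)"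
    unfolding poly_altdef using assms by (intro sum.mono_neutral_left) (auto simp: coeff_eq_0)
  also have "\<bar>\<dots>\<bar> \<le> (\<Sum>i\<le>N. \<bar>coeff P i * x ^ i\<bar>)" by (rule sum_abs)
  also have "\<dots> \<le> (\<Sum>i\<le>N. \<bar>x\<bar> ^ i * height P)"
    by (intro sum_mono) (simp add: abs_mult power_abs mult.commute mult_right_mono abs_coeff_le_height)
  finally show ?thesis by (simp add: sum_distrib_right)
qed

text \<open>A polynomial of degree at most \<open>n\<close> can be small compared to its height at no more than
  \<open>n\<close> of the \<open>2 n + 1\<close> points \<open>0, \<dots>, 2 n\<close>, so two such polynomials are simultaneously large
  at one of them.\<close>

lemma height_mult_ge:
  "\<exists>C\<ge>1. \<forall>P Q. degree P \<le> n \<longrightarrow> degree Q \<le> n \<longrightarrow> height P * height Q \<le> C * height (P * Q)"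
proof -
  define T where "T = {0..2 * int n}"
  \<comment> \<open>The condition \<open>S \<subseteq> T\<close> stands inside the existential so
    that the constants can be chosen as a total function of \<open>S\<close>.\<close>
  have "\<forall>S. \<exists>K\<ge>0. S \<subseteq> T \<longrightarrow> (\<forall>P :: int poly. \<forall>M. (\<forall>i\<ge>card S. coeff P i = 0) \<longrightarrow> (\<forall>x\<in>S. \<bar>poly P x\<bar> \<le> M) \<longrightarrow>
    (\<forall>i. \<bar>coeff P i\<bar> \<le> K * M))"
  proof
    fix S
    show "\<exists>K\<ge>0. S \<subseteq> T \<longrightarrow> (\<forall>P :: int poly. \<forall>M. (\<forall>i\<ge>card S. coeff P i = 0) \<longrightarrow> (\<forall>x\<in>S. \<bar>poly P x\<bar> \<le> M) \<longrightarrow>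
      (\<forall>i. \<bar>coeff P i\<bar> \<le> K * M))"
    proof (cases "S \<subseteq> T")
      case True
      then have "finite S" by (rule finite_subset) (simp add: T_def)
      from coeff_bound_from_values[OF this] show ?thesis by blast
    qed auto
  qed
  then obtain K where K0: "\<And>S. K S \<ge> 0" and K: "\<And>S P M i. \<lbrakk>S \<subseteq> T; \<forall>i\<ge>card S. coeff P i = 0; \<forall>x\<in>S. \<bar>poly P x\<bar> \<le> M\<rbrakk> \<Longrightarrow>
    \<bar>coeff P i\<bar> \<le> K S * M"
    by metis
  define L where "L = (\<Sum>S\<in>Pow T. K S)"
  have fin: "finite (Pow T)" by (simp add: T_def)
  have KL: "K S \<le> L" if "S \<subseteq> T" for S
    unfolding L_def using fin that K0 by (intro member_le_sum) auto
  have L0: "L \<ge> 0" unfolding L_def using K0 by (intro sum_nonneg)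
  \<comment> \<open>With \<open>n + 1\<close> bad nodes, interpolation through them would bound the
    height of \<open>P\<close> by something smaller than itself, as \<open>L\<close> dominates every
    interpolation constant.\<close>
  define bad where "bad P = {x \<in> T. L * \<bar>poly P x\<bar> < height P}" for P
  have bad: "card (bad P) \<le> n" if P: "degree P \<le> n" for P
  proof (rule ccontr)
    assume "\<not> card (bad P) \<le> n"
    then obtain S where S: "S \<subseteq> bad P" "card S = n + 1"
      using obtain_subset_with_card_n[of "n + 1" "bad P"] by auto
    then have fS: "finite S" "S \<noteq> {}" by (auto simp: card_ge_0_finite)
    define M where "M = Max ((\<lambda>x. \<bar>poly P x\<bar>) ` S)"
    have "M \<in> (\<lambda>x. \<bar>poly P x\<bar>) ` S" unfolding M_def using fS by (intro Max_in) auto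
    then obtain y where y: "y \<in> S" "M = \<bar>poly P y\<bar>" by auto
    have ST: "S \<subseteq> T" using S(1) by (auto simp: bad_def)
    have "\<bar>coeff P i\<bar> \<le> K S * M" for i
      using ST S(2) P fS by (intro K) (auto simp: M_def intro!: coeff_eq_0)
    then have "height P \<le> K S * M" by (rule height_leI)
    also have "\<dots> \<le> L * M" using KL[OF ST] y by (intro mult_right_mono) auto
    also have "\<dots> < height P" using y S(1) by (auto simp: bad_def)
    finally show False by simp
  qed
  define C where "C = (\<Sum>i\<le>2 * n. (2 * int n) ^ i)"
  have "height P * height Q \<le> (L * L * C + 1) * height (P * Q)" if PQ: "degree P \<le> n" "degree Q \<le> n" for P Q
  proof -
    \<comment> \<open>The two bad sets cover at most \<open>2 * n\<close> of the
      \<open>2 * n + 1\<close> nodes, so some node is good for both factors.\<close>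
    have "card (bad P \<union> bad Q) \<le> n + n"
      using card_Un_le[of "bad P" "bad Q"] bad[OF PQ(1)] bad[OF PQ(2)] by linarith
    also have "n + n < card T" by (simp add: T_def)
    finally have "card (bad P \<union> bad Q) < card T" .
    moreover have "bad P \<union> bad Q \<subseteq> T" by (auto simp: bad_def)
    then have fin: "finite (bad P \<union> bad Q)" by (rule finite_subset) (simp add: T_def)
    ultimately have "\<not> T \<subseteq> bad P \<union> bad Q"
      using card_mono[OF fin, of T] by linarith
    then obtain x where x: "x \<in> T" "height P \<le> L * \<bar>poly P x\<bar>" "height Q \<le> L * \<bar>poly Q x\<bar>"
      unfolding bad_def by fastforce
    have "height P * height Q \<le> (L * \<bar>poly P x\<bar>) * (L * \<bar>poly Q x\<bar>)"
      using x L0 height_nonneg by (intro mult_mono) auto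
    also have "\<dots> = L * L * \<bar>poly (P * Q) x\<bar>" by (simp add: abs_mult algebra_simps)
    also have "\<dots> \<le> L * L * (C * height (P * Q))"
    proof (intro mult_left_mono)
      have "\<bar>poly (P * Q) x\<bar> \<le> (\<Sum>i\<le>2 * n. \<bar>x\<bar> ^ i) * height (P * Q)"
        using PQ degree_mult_le[of P Q] by (intro abs_poly_le_height) simp
      also have "\<dots> \<le> C * height (P * Q)"
        unfolding C_def using x(1) height_nonneg
        by (intro mult_right_mono sum_mono power_mono) (auto simp: T_def)
      finally show "\<bar>poly (P * Q) x\<bar> \<le> C * height (P * Q)" .
    qed (use L0 in simp)
    also have "\<dots> \<le> (L * L * C + 1) * height (P * Q)"
      using height_nonneg[of "P * Q"] by (simp add: algebra_simps)
    finally show ?thesis .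
  qed
  moreover have "L * L * C + 1 \<ge> 1" 
    using L0 by (auto simp: C_def intro!: mult_nonneg_nonneg sum_nonneg)
  ultimately show ?thesis by blast
qed

section \<open>Passage from arbitrary polynomials to irreducible ones\<close>

text \<open>If no factorisation lowers both degrees, the primitive part is irreducible and hence
  prime by Gauss's lemma. This dichotomy drives the induction on the degree.\<close>

lemma prime_elem_primitive_part_or_reducible:
  fixes P :: "int poly"
  assumes "degree P > 0"
  shows "prime_elem (primitive_part P) \<or> (\<exists>A B. P = A * B \<and> degree A < degree P \<and> degree B < degree P)"
proof (rule disjCI)
  assume *: "\<not> (\<exists>A B. P = A * B \<and> degree A < degree P \<and> degree B < degree P)"
  define R where "R = primitive_part P"
  have P0: "P \<noteq> 0" using assms by auto
  have PR: "P = smult (content P) R" by (simp add: R_def)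
  have deg: "degree R = degree P" by (simp add: R_def)
  have con: "content R = 1" using P0 by (simp add: R_def)
  have "irreducible R"
  proof (rule irreducibleI)
    show "R \<noteq> 0" using P0 by (simp add: R_def)
    show "\<not> R dvd 1" using assms deg by (auto simp: is_unit_poly_iff)
    fix A B assume AB: "R = A * B"
    have nz: "A \<noteq> 0" "B \<noteq> 0" using AB P0 by (auto simp: R_def)
    have sum: "degree A + degree B = degree P" using AB nz deg by (simp add: degree_mult_eq)
    have "P = smult (content P) A * B" using PR AB by simp
    with * have "\<not> (degree (smult (content P) A) < degree P \<and> degree B < degree P)" by blast
    then have "degree A = 0 \<or> degree B = 0" using sum P0 by auto
    \<comment> \<open>A constant divisor of \<open>R\<close> divides its content, which is
      1.\<close>
    moreover have unit: "X dvd 1" if "degree X = 0" "X dvd R" for X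
    proof -
      from that(1) obtain a where a: "X = [:a:]" by (rule degree_eq_zeroE)
      with that(2) con have "a dvd 1" by (simp add: const_poly_dvd_iff_dvd_content)
      with a show ?thesis by (simp add: is_unit_const_poly_iff)
    qed
    ultimately show "A dvd 1 \<or> B dvd 1" using AB by auto
  qed
  then show "prime_elem (primitive_part P)" by (simp add: R_def irreducible_imp_prime_poly)
qed

text \<open>Values are multiplicative and heights are so up to a constant, hence a lower bound with
  exponent \<open>e\<close> passes to products with the same \<open>e\<close>. Only the constant
  deteriorates, once per degree step.\<close>

lemma ipoly_lower_bound_of_prime_elem:
  fixes \<zeta> K :: real
  assumes K: "\<And>Q. prime_elem Q \<Longrightarrow> degree Q \<le> n \<Longrightarrow> 1 \<le> K * \<bar>ipoly Q \<zeta>\<bar> * of_int (height Q) ^ e"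
    and "d \<le> n"
  shows "\<exists>K'. \<forall>P. P \<noteq> 0 \<longrightarrow> degree P \<le> d \<longrightarrow> 1 \<le> K' * \<bar>ipoly P \<zeta>\<bar> * of_int (height P) ^ e"
  using \<open>d \<le> n\<close>
proof (induction d)
  case 0
  show ?case
  proof (intro exI[of _ 1] allI impI)
    fix P :: "int poly" assume "P \<noteq> 0" "degree P \<le> 0"
    then obtain a where "P = [:a:]" "a \<noteq> 0" by (metis bot_nat_0.extremum_uniqueI degree_eq_zeroE pCons_0_0)
    moreover from this have "1 \<le> \<bar>real_of_int a\<bar>" by linarith
    ultimately show "1 \<le> 1 * \<bar>ipoly P \<zeta>\<bar> * of_int (height P) ^ e"
      using mult_mono[of 1 "\<bar>real_of_int a\<bar>" 1 "\<bar>real_of_int a\<bar> ^ e"] by simp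
  qed
next
  case (Suc d)
  then obtain K' where K': "\<And>P. P \<noteq> 0 \<Longrightarrow> degree P \<le> d \<Longrightarrow> 1 \<le> K' * \<bar>ipoly P \<zeta>\<bar> * of_int (height P) ^ e"
    by auto
  obtain C where C: "C \<ge> 1" "\<And>P Q. degree P \<le> n \<Longrightarrow> degree Q \<le> n \<Longrightarrow> height P * height Q \<le> C * height (P * Q)"
    using height_mult_ge[of n] by auto
  \<comment> \<open>The constant of the product case: two lower bounds multiplied, with
    \<open>C ^ e\<close> paying for the comparison of heights. \<open>K2\<close> dominates the
    constants of all three cases.\<close>
  define u where "u = K' ^ 2 * real_of_int C ^ e"
  define K2 where "K2 = \<bar>K'\<bar> + \<bar>K\<bar> + u"
  have "u \<ge> 0" using C(1) by (simp add: u_def)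
  then have le: "K' \<le> K2" "K \<le> K2" "u \<le> K2" and K2: "K2 \<ge> 0"
    unfolding K2_def by linarith+
  have bound: "1 \<le> K2 * \<bar>ipoly P \<zeta>\<bar> * of_int (height P) ^ e"
    if "1 \<le> k * \<bar>ipoly P \<zeta>\<bar> * of_int (height P) ^ e" "k \<le> K2" for k P
    by (rule order.trans[OF that(1)], intro mult_right_mono that(2)) (auto simp: height_nonneg)
  show ?case
  proof (intro exI[of _ K2] allI impI)
    fix P :: "int poly" assume P: "P \<noteq> 0" "degree P \<le> Suc d"
    show "1 \<le> K2 * \<bar>ipoly P \<zeta>\<bar> * of_int (height P) ^ e"
    proof (cases "degree P \<le> d")
      case True
      show ?thesis using bound[OF K'[OF P(1) True] le(1)] .
    next
      case False
      then have dP: "degree P = Suc d" using P by simp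
      then consider "prime_elem (primitive_part P)"
        | A B where "P = A * B" "degree A < degree P" "degree B < degree P"
        using prime_elem_primitive_part_or_reducible[of P] by auto
      then show ?thesis
      proof cases
        case 1
        define R where "R = primitive_part P"
        have R: "1 \<le> K * \<bar>ipoly R \<zeta>\<bar> * of_int (height R) ^ e"
          using 1 dP Suc.prems by (intro K) (auto simp: R_def)
        have c: "content P \<noteq> 0" using P by simp
        have PR: "P = smult (content P) R" by (simp add: R_def)
        \<comment> \<open>Multiplying by the nonzero content can only increase the value and the
          height.\<close>
        have "\<bar>ipoly R \<zeta>\<bar> \<le> \<bar>ipoly P \<zeta>\<bar>"
        proof -
          have "1 \<le> \<bar>real_of_int (content P)\<bar>" using c by linarith
          then show ?thesis by (subst PR) (simp add: abs_mult mult_le_cancel_right1)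
        qed
        moreover have "real_of_int (height R) ^ e \<le> of_int (height P) ^ e"
          using height_smult_ge[OF c, of R] PR height_nonneg[of R] by (intro power_mono) auto
        ultimately have "K2 * \<bar>ipoly R \<zeta>\<bar> * of_int (height R) ^ e \<le> K2 * \<bar>ipoly P \<zeta>\<bar> * of_int (height P) ^ e"
          using height_nonneg[of R] K2 by (intro mult_mono) auto
        with bound[OF R le(2)] show ?thesis by linarith
      next
        case 2
        have nz: "A \<noteq> 0" "B \<noteq> 0" using 2 P by auto
        have dAB: "degree A \<le> d" "degree B \<le> d" using 2 dP by auto
        have hAB: "real_of_int (height A) * of_int (height B) \<le> of_int C * of_int (height P)"
          using C(2)[of A B] dAB Suc.prems 2(1) by (simp flip: of_int_mult)
        have "1 * 1 \<le> (K' * \<bar>ipoly A \<zeta>\<bar> * of_int (height A) ^ e) * (K' * \<bar>ipoly B \<zeta>\<bar> * of_int (height B) ^ e)"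
          using K'[OF nz(1) dAB(1)] K'[OF nz(2) dAB(2)] by (intro mult_mono) auto
        also have "\<dots> = K' ^ 2 * \<bar>ipoly P \<zeta>\<bar> * (of_int (height A) * of_int (height B)) ^ e"
          by (simp add: 2(1) abs_mult power_mult_distrib power2_eq_square)
        also have "\<dots> \<le> K' ^ 2 * \<bar>ipoly P \<zeta>\<bar> * (of_int C * of_int (height P)) ^ e"
          using hAB height_nonneg[of A] height_nonneg[of B] by (intro mult_left_mono power_mono) auto
        finally have "1 \<le> u * \<bar>ipoly P \<zeta>\<bar> * of_int (height P) ^ e"
          by (simp add: u_def power_mult_distrib mult_ac)
        from bound[OF this le(3)] show ?thesis .
      qed
    qed
  qed
qed

section \<open>Best approximations\<close>

lemma powr_neg_eventually_small:
  fixes a C :: real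
  assumes "a < 0"
  shows "\<exists>B\<ge>1. \<forall>x\<ge>B. C * x powr a < 1"
\<comment> \<open>The threshold solves \<open>x powr a = 1 / (\<bar>C\<bar> + 1)\<close>.\<close>
proof (intro exI[of _ "max 1 ((\<bar>C\<bar> + 1) powr (- 1 / a))"] conjI allI impI)
  fix x assume "max 1 ((\<bar>C\<bar> + 1) powr (- 1 / a)) \<le> x"
  then have x: "x \<ge> 1" "(\<bar>C\<bar> + 1) powr (- 1 / a) \<le> x" by auto
  then have "x powr a \<le> ((\<bar>C\<bar> + 1) powr (- 1 / a)) powr a"
    using assms by (intro powr_mono2') auto
  also have "\<dots> = 1 / (\<bar>C\<bar> + 1)"
    using assms by (subst powr_powr) (simp add: powr_minus_divide)
  finally have "C * x powr a \<le> \<bar>C\<bar> * (1 / (\<bar>C\<bar> + 1))"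
    by (intro mult_mono) auto
  also have "\<dots> < 1" by simp
  finally show "C * x powr a < 1" .
qed simp

text \<open>Among all polynomials with value below \<delta>, one of least height is a best
  approximation: anything of smaller height has value at least \<delta>.\<close>

lemma best_approx_below:
  assumes "Q \<noteq> 0" "degree Q \<le> n" "\<bar>ipoly Q \<zeta>\<bar> < \<delta>"
  obtains P where "best_approx n \<zeta> P" "\<bar>ipoly P \<zeta>\<bar> < \<delta>" "height P \<le> height Q"
proof -
  let ?S = "\<lambda>P. P \<noteq> 0 \<and> degree P \<le> n \<and> \<bar>ipoly P \<zeta>\<bar> < \<delta>"
  obtain P where P: "?S P" "\<And>R. ?S R \<Longrightarrow> nat (height P) \<le> nat (height R)"
    using ex_has_least_nat[of ?S Q "\<lambda>P. nat (height P)"] assms by blast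
  have "best_approx n \<zeta> P"
    unfolding best_approx_def
  proof (intro conjI allI impI)
    fix R assume R: "R \<noteq> 0 \<and> degree R \<le> n \<and> height R < height P"
    then have "\<not> ?S R" using P(2)[of R] height_nonneg[of R] by linarith
    with R P(1) show "\<bar>ipoly P \<zeta>\<bar> < \<bar>ipoly R \<zeta>\<bar>" by auto
  qed (use P(1) in auto)
  moreover have "height P \<le> height Q"
    using P(2)[of Q] assms height_nonneg[of Q] by linarith
  ultimately show ?thesis using that P(1) by blast
qed

lemma best_approx_height_mono:
  assumes "best_approx n \<zeta> P" "best_approx n \<zeta> Q" "\<bar>ipoly P \<zeta>\<bar> \<le> \<bar>ipoly Q \<zeta>\<bar>"
  shows "height Q \<le> height P"
proof (rule ccontr)
  assume "\<not> height Q \<le> height P"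
  then have "\<bar>ipoly Q \<zeta>\<bar> < \<bar>ipoly P \<zeta>\<bar>"
    using assms(1,2) by (simp add: best_approx_def)
  with assms(3) show False by simp
qed

section \<open>Enumeration of the best approximations\<close>

text \<open>Start at the maximum and always pass to the largest element below. An element never
  reached would lie below all infinitely many chosen ones, contradicting the finiteness of its upper
  part.\<close>

lemma infinite_real_set_decreasing_enum:
  fixes V :: "real set"
  assumes inf: "infinite V" and fin: "\<And>v. v \<in> V \<Longrightarrow> finite {u \<in> V. v \<le> u}"
  obtains f :: "nat \<Rightarrow> real" where "\<And>k. f (Suc k) < f k" "range f = V"
proof -
  have max: "\<exists>m\<in>W. \<forall>t\<in>W. t \<le> m" if W: "W \<subseteq> V" "w \<in> W" for W w
  proof -
    let ?U = "{u \<in> W. w \<le> u}"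
    have f: "finite ?U" using W by (intro finite_subset[OF _ fin[of w]]) auto
    have ne: "w \<in> ?U" using W by simp
    have "Max ?U \<in> ?U" using f ne by (intro Max_in) auto
    moreover have "t \<le> Max ?U" if "t \<in> W" for t
    proof (cases "w \<le> t")
      case True
      then show ?thesis using f that by (intro Max_ge) auto
    next
      case False
      have "w \<le> Max ?U" using f ne by (intro Max_ge) auto
      with False show ?thesis by linarith
    qed
    ultimately show ?thesis by blast
  qed
  obtain v0 where "v0 \<in> V" using infinite_imp_nonempty[OF inf] by auto
  then obtain m where m: "m \<in> V" "\<And>t. t \<in> V \<Longrightarrow> t \<le> m" using max[of V v0] by auto
  have step: "\<exists>u. u \<in> V \<and> u < v \<and> (\<forall>t\<in>V. t < v \<longrightarrow> t \<le> u)" if v: "v \<in> V" for v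
  proof -
    have "\<not> V \<subseteq> {u \<in> V. v \<le> u}" using inf fin[OF v] finite_subset by blast
    then obtain w where "w \<in> V" "\<not> v \<le> w" by blast
    then have "w \<in> {u \<in> V. u < v}" by simp
    then show ?thesis using max[of "{u \<in> V. u < v}" w] by auto
  qed
  obtain f where f0: "f 0 = m" and fV: "\<And>k. f k \<in> V"
    and f: "\<And>k. f (Suc k) < f k \<and> (\<forall>t\<in>V. t < f k \<longrightarrow> t \<le> f (Suc k))"
  proof -
    have "\<exists>f. \<forall>k. (f k \<in> V \<and> (k = 0 \<longrightarrow> f k = m)) \<and>
        (f (Suc k) < f k \<and> (\<forall>t\<in>V. t < f k \<longrightarrow> t \<le> f (Suc k)))"
      by (rule dependent_nat_choice) (use m(1) step in auto)
    then show ?thesis using that by blast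
  qed
  have "v \<in> range f" if v: "v \<in> V" for v
  proof (rule ccontr)
    assume nv: "v \<notin> range f"
    have gt: "v < f k" for k
    proof (induction k)
      case 0
      show ?case using m(2)[OF v] f0 nv by (metis order_le_less rangeI)
    next
      case (Suc k)
      then show ?case using f v nv by (metis order_le_less rangeI)
    qed
    have "inj f"
    proof (rule injI)
      have "strict_mono (\<lambda>k. - f k)" using f by (simp add: strict_mono_Suc_iff)
      then show "x = y" if "f x = f y" for x y using that strict_mono_eq by metis
    qed
    then have "infinite (range f)" by (simp add: finite_image_iff)
    moreover have "range f \<subseteq> {u \<in> V. v \<le> u}" using gt fV by (auto intro: less_imp_le)
    ultimately show False using fin[OF v] finite_subset by blast
  qed
  then show ?thesis using that[of f] f fV by blast
qed

text \<open>The absolute values taken by best approximations are enumerated. Their upper parts are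
  finite because a larger value means a smaller height, and by transcendence equal absolute values
  belong to polynomials equal up to sign.\<close>

lemma best_approx_seq_exists:
  assumes \<zeta>: "\<not> algebraic \<zeta>"
    and small: "\<And>\<delta>. \<delta> > 0 \<Longrightarrow> \<exists>Q. Q \<noteq> 0 \<and> degree Q \<le> n \<and> \<bar>ipoly Q \<zeta>\<bar> < \<delta>"
  shows "\<exists>P. best_approx_seq n \<zeta> P"
proof -
  define V where "V = (\<lambda>P. \<bar>ipoly P \<zeta>\<bar>) ` {P. best_approx n \<zeta> P}"
  have pos: "v > 0" if "v \<in> V" for v
    using that ipoly_eq_0_iff[OF \<zeta>] by (auto simp: V_def best_approx_def)
  have below: "\<exists>v\<in>V. v < \<delta>" if \<delta>: "\<delta> > 0" for \<delta>
  proof -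
    obtain Q where Q: "Q \<noteq> 0" "degree Q \<le> n" "\<bar>ipoly Q \<zeta>\<bar> < \<delta>" using small[OF \<delta>] by blast
    obtain P where "best_approx n \<zeta> P" "\<bar>ipoly P \<zeta>\<bar> < \<delta>" by (rule best_approx_below[OF Q])
    then show ?thesis by (auto simp: V_def)
  qed
  have "infinite V"
  proof
    assume fin: "finite V"
    have ne: "V \<noteq> {}" using below[of 1] by auto
    from below[OF pos[OF Min_in[OF fin ne]]] obtain v where "v \<in> V" "v < Min V" by blast
    with fin show False by (meson Min_le leD)
  qed
  moreover have "finite {u \<in> V. v \<le> u}" if "v \<in> V" for v
  proof -
    from that obtain P where P: "best_approx n \<zeta> P" "v = \<bar>ipoly P \<zeta>\<bar>" by (auto simp: V_def)
    have "{u \<in> V. v \<le> u} \<subseteq> (\<lambda>P. \<bar>ipoly P \<zeta>\<bar>) ` {Q. degree Q \<le> n \<and> height Q \<le> height P}"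
      using best_approx_height_mono[OF P(1)] P(2) by (auto simp: V_def best_approx_def)
    then show ?thesis using finite_bounded_height finite_surj by blast
  qed
  ultimately obtain f where f: "\<And>k. f (Suc k) < f k" "range f = V"
    using infinite_real_set_decreasing_enum by metis
  then have "\<forall>k. \<exists>P. best_approx n \<zeta> P \<and> \<bar>ipoly P \<zeta>\<bar> = f k"
    by (auto simp: V_def image_def set_eq_iff) metis
  then obtain P where P: "\<And>k. best_approx n \<zeta> (P k)" "\<And>k. \<bar>ipoly (P k) \<zeta>\<bar> = f k"
    by metis
  have "\<exists>k. Q = P k \<or> Q = - P k" if Q: "best_approx n \<zeta> Q" for Q
  proof -
    have "\<bar>ipoly Q \<zeta>\<bar> \<in> range f" using Q f(2) by (auto simp: V_def)
    then obtain k where "\<bar>ipoly Q \<zeta>\<bar> = \<bar>ipoly (P k) \<zeta>\<bar>" using P(2) by auto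
    then have "ipoly (Q - P k) \<zeta> = 0 \<or> ipoly (Q + P k) \<zeta> = 0" by (auto simp: abs_eq_iff)
    then have "Q - P k = 0 \<or> Q + P k = 0" unfolding ipoly_eq_0_iff[OF \<zeta>] .
    then show ?thesis by (auto simp: eq_neg_iff_add_eq_0)
  qed
  then have "best_approx_seq n \<zeta> P"
    using P f(1) by (auto simp: best_approx_seq_def)
  then show ?thesis by blast
qed

lemma best_approx_seq_antimono:
  assumes "best_approx_seq n \<zeta> P" "i \<le> j"
  shows "\<bar>ipoly (P j) \<zeta>\<bar> \<le> \<bar>ipoly (P i) \<zeta>\<bar>"
proof -
  have "\<bar>ipoly (P (Suc k)) \<zeta>\<bar> \<le> \<bar>ipoly (P k) \<zeta>\<bar>" for k
    using assms(1) by (simp add: best_approx_seq_def less_imp_le)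
  then show ?thesis using lift_Suc_antimono_le[of "\<lambda>k. \<bar>ipoly (P k) \<zeta>\<bar>"] assms(2) by blast
qed

lemma best_approx_seq_height_mono:
  assumes "best_approx_seq n \<zeta> P" "i \<le> j"
  shows "height (P i) \<le> height (P j)"
  using best_approx_height_mono[of n \<zeta> "P j" "P i"] best_approx_seq_antimono[OF assms] assms(1)
  by (simp add: best_approx_seq_def)

text \<open>Strictly decreasing values make the sequence injective, so it leaves every finite set of
  bounded height; monotonicity of heights then covers all later indices.\<close>

lemma best_approx_seq_height_unbounded:
  assumes "best_approx_seq n \<zeta> P"
  shows "\<exists>k0. \<forall>k\<ge>k0. height (P k) > B"
proof -
  have "inj P"
  proof (rule injI)
    have "strict_mono (\<lambda>k. - \<bar>ipoly (P k) \<zeta>\<bar>)"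
      using assms by (simp add: strict_mono_Suc_iff best_approx_seq_def)
    then show "x = y" if "P x = P y" for x y using that strict_mono_eq by metis
  qed
  then have "infinite (range P)" by (simp add: finite_image_iff)
  then have "\<not> range P \<subseteq> {P. degree P \<le> n \<and> height P \<le> B}"
    using finite_bounded_height finite_subset by blast
  moreover have "degree (P k) \<le> n" for k
    using assms by (simp add: best_approx_seq_def best_approx_def)
  ultimately obtain k0 where "height (P k0) > B"
    by (auto simp: image_subset_iff not_le)
  then show ?thesis
    using best_approx_seq_height_mono[OF assms, of k0] by (intro exI[of _ k0]) (auto intro: less_le_trans)
qed

section \<open>Uniform approximation in terms of best approximations\<close>

text \<open>The condition on \<nu> whose supremum is \<open>hat_w n \<zeta>\<close>; an upper bound
  there amounts to refuting it for one exponent.\<close>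

definition uniformly_approximable :: "nat \<Rightarrow> real \<Rightarrow> real \<Rightarrow> bool" where
  "uniformly_approximable n \<zeta> \<nu> \<longleftrightarrow> (\<forall>\<^sub>F X :: real in at_top. \<exists>P :: int poly.
     P \<noteq> 0 \<and> degree P \<le> n \<and> of_int (height P) \<le> X \<and> \<bar>ipoly P \<zeta>\<bar> \<le> X powr (- \<nu>))"

lemma uniformly_approximable_mono:
  assumes "uniformly_approximable n \<zeta> \<nu>" "\<mu> \<le> \<nu>"
  shows "uniformly_approximable n \<zeta> \<mu>"
  using assms(1) eventually_ge_at_top[of 1] unfolding uniformly_approximable_def
proof eventually_elim
  case (elim X)
  then have "X powr (- \<nu>) \<le> X powr (- \<mu>)" using assms(2) by (intro powr_mono) auto
  with elim show ?case by (meson order.trans)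
qed

lemma uniformly_approximable_eventually:
  assumes "uniformly_approximable n \<zeta> \<nu>"
  shows "\<exists>X0>0. \<forall>X\<ge>X0. \<exists>P. P \<noteq> 0 \<and> degree P \<le> n \<and>
    of_int (height P) \<le> X \<and> \<bar>ipoly P \<zeta>\<bar> \<le> X powr (- \<nu>)"
proof -
  obtain X1 where "\<forall>X\<ge>X1. \<exists>P. P \<noteq> 0 \<and> degree P \<le> n \<and>
    of_int (height P) \<le> X \<and> \<bar>ipoly P \<zeta>\<bar> \<le> X powr (- \<nu>)"
    using assms unfolding uniformly_approximable_def eventually_at_top_linorder by blast
  then show ?thesis by (intro exI[of _ "max 1 X1"]) simp
qed

text \<open>For \<open>X\<close> just below the height of \<open>P (Suc k)\<close>, no polynomial of
  height at most \<open>X\<close> has a smaller value than \<open>P k\<close>. The uniform bound at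
  \<open>X\<close> therefore applies to \<open>P k\<close>, and \<open>X\<close> tends to that
  height from the left.\<close>

lemma best_approx_seq_upper_bound:
  assumes seq: "best_approx_seq n \<zeta> P" and unif: "uniformly_approximable n \<zeta> \<nu>"
  shows "\<exists>k0. \<forall>k\<ge>k0. \<bar>ipoly (P k) \<zeta>\<bar> \<le> of_int (height (P (Suc k))) powr (- \<nu>)"
proof -
  obtain X0 where X0: "X0 > 0" "\<And>X. X \<ge> X0 \<Longrightarrow> \<exists>P. P \<noteq> 0 \<and> degree P \<le> n \<and>
    of_int (height P) \<le> X \<and> \<bar>ipoly P \<zeta>\<bar> \<le> X powr (- \<nu>)"
    using uniformly_approximable_eventually[OF unif] by blast
  obtain k0 where k0: "\<And>k. k \<ge> k0 \<Longrightarrow> height (P k) > \<lceil>X0\<rceil>"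
    using best_approx_seq_height_unbounded[OF seq] by blast
  show ?thesis
  proof (intro exI[of _ k0] allI impI)
    fix k assume k: "k \<ge> k0"
    define h where "h = real_of_int (height (P (Suc k)))"
    have h: "X0 < h" using k0[of "Suc k"] k unfolding h_def by linarith
    have le: "\<bar>ipoly (P k) \<zeta>\<bar> \<le> X powr (- \<nu>)" if X: "X0 \<le> X" "X < h" for X
    proof (rule ccontr)
      assume "\<not> ?thesis"
      with X0(2)[OF X(1)] obtain Q where Q: "Q \<noteq> 0" "degree Q \<le> n" "of_int (height Q) \<le> X"
        "\<bar>ipoly Q \<zeta>\<bar> < \<bar>ipoly (P k) \<zeta>\<bar>" by force
      obtain R where R: "best_approx n \<zeta> R" "\<bar>ipoly R \<zeta>\<bar> < \<bar>ipoly (P k) \<zeta>\<bar>" "height R \<le> height Q"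
        by (rule best_approx_below[OF Q(1,2,4)])
      obtain j where j: "R = P j \<or> R = - P j" using seq R(1) unfolding best_approx_seq_def by blast
      then have "\<bar>ipoly (P j) \<zeta>\<bar> < \<bar>ipoly (P k) \<zeta>\<bar>" using R(2) by auto
      then have "Suc k \<le> j" using best_approx_seq_antimono[OF seq, of j k] by (meson leD not_less_eq_eq)
      then have "height (P (Suc k)) \<le> height (P j)" by (rule best_approx_seq_height_mono[OF seq])
      also have "\<dots> = height R" using j by auto
      finally have "h \<le> X" using R(3) Q(3) unfolding h_def by linarith
      with X(2) show False by simp
    qed
    \<comment> \<open>At \<open>X = h\<close> itself \<open>P (Suc k)\<close> is admissible, so the
      bound for \<open>P k\<close> is only reached as a limit.\<close>
    have "((\<lambda>X. X powr (- \<nu>)) \<longlongrightarrow> h powr (- \<nu>)) (at_left h)"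
      using h X0(1) by (intro tendsto_intros) auto
    moreover have "\<forall>\<^sub>F X in at_left h. \<bar>ipoly (P k) \<zeta>\<bar> \<le> X powr (- \<nu>)"
      using eventually_at_left_real[OF h] by eventually_elim (auto intro: le)
    ultimately show "\<bar>ipoly (P k) \<zeta>\<bar> \<le> h powr (- \<nu>)"
      by (rule tendsto_lowerbound) simp
  qed
qed

text \<open>Along the sequence values decrease and heights increase, so the dominant determinant
  term pairs the value of \<open>P k\<close> with the heights of the other \<open>n\<close>
  polynomials.\<close>

lemma consec_lin_indep_height_bound:
  assumes seq: "best_approx_seq n \<zeta> P" and ind: "consec_lin_indep n P k"
  shows "1 \<le> fact (n + 1) * (\<bar>ipoly (P k) \<zeta>\<bar> * (\<Prod>i<n. real_of_int (height (P (k + Suc i)))))"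
proof (rule det_height_bound[where F = "\<lambda>i. P (k + i)" and \<zeta> = \<zeta>])
  have ba: "best_approx n \<zeta> (P i)" for i using seq by (simp add: best_approx_seq_def)
  show "degree (P (k + i)) < n + 1" "P (k + i) \<noteq> 0" for i
    using ba[of "k + i"] by (auto simp: best_approx_def)
  fix c assume c: "(\<Sum>i<n + 1. smult (c i) (P (k + i))) = 0"
  have "(\<Sum>i\<le>n. real_of_int (c i) * real_of_int (coeff (P (k + i)) j)) = 0" for j
  proof -
    have "(\<Sum>i\<le>n. c i * coeff (P (k + i)) j) = 0"
      using arg_cong[OF c, of "\<lambda>p. coeff p j"] by (simp add: coeff_sum lessThan_Suc_atMost)
    then show ?thesis by (simp flip: of_int_mult of_int_sum)
  qed
  then show "\<forall>i<n + 1. c i = 0"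
    using ind[unfolded consec_lin_indep_def, rule_format, of "\<lambda>i. real_of_int (c i)"]
    by (simp add: less_Suc_eq_le)
next
  fix i assume "i < n + 1"
  let ?h = "\<lambda>i. real_of_int (height (P (k + i)))"
  have pr: "(\<Prod>i<n. ?h (Suc i)) \<ge> 0" by (intro prod_nonneg) (simp add: height_nonneg)
  have "\<bar>ipoly (P (k + i)) \<zeta>\<bar> * (\<Prod>j<n + 1. ?h j)
      = (\<bar>ipoly (P (k + i)) \<zeta>\<bar> * (\<Prod>i<n. ?h (Suc i))) * ?h 0"
    by (simp add: prod.lessThan_Suc_shift del: prod.lessThan_Suc)
  also have "\<dots> \<le> (\<bar>ipoly (P k) \<zeta>\<bar> * (\<Prod>i<n. ?h (Suc i))) * ?h i"
    using best_approx_seq_antimono[OF seq, of k "k + i"] best_approx_seq_height_mono[OF seq, of k "k + i"] pr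
    by (intro mult_mono) (auto simp: height_nonneg)
  finally show "\<bar>ipoly (P (k + i)) \<zeta>\<bar> * (\<Prod>j<n + 1. ?h j)
      \<le> (\<bar>ipoly (P k) \<zeta>\<bar> * (\<Prod>i<n. ?h (Suc i))) * ?h i" .
qed simp

section \<open>The uniform exponent\<close>

text \<open>The geometric sum equals \<open>n * ((1 + 1 / n) ^ n - 1)\<close>, at most
  \<open>(e - 1) * n\<close>, and \<open>e < 11 / 4\<close>.\<close>

lemma sum_powers_one_plus_inverse_le:
  assumes "n > 0"
  shows "(\<Sum>i<n. (1 + 1 / real n) ^ i) \<le> 7 / 4 * real n"
proof -
  have "(1 + 1 / real n) ^ n \<le> exp (1 / real n) ^ n"
    by (intro power_mono exp_ge_add_one_self) auto
  also have "\<dots> = exp 1"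
    using assms by (simp flip: exp_of_nat_mult)
  also have "\<dots> \<le> 11 / 4"
    using e_less_272 by simp
  finally have *: "(1 + 1 / real n) ^ n \<le> 11 / 4" .
  have "(\<Sum>i<n. (1 + 1 / real n) ^ i) = real n * ((1 + 1 / real n) ^ n - 1)"
    using assms by (subst geometric_sum) auto
  also have "\<dots> \<le> real n * (7 / 4)"
    using * by (intro mult_left_mono) auto
  finally show ?thesis by simp
qed

text \<open>If all quotients of logarithms of consecutive heights were at most \<open>G = 1 + 1 / n\<close>, then the
  determinant bound would give \<open>\<nu> \<le> 1 + G + \<dots> + G ^ (n - 1)\<close>. Hence some quotient exceeds \<open>G\<close>,
  and the uniform exponent \<open>\<nu>\<close> improves to the ordinary exponent \<open>G \<nu>\<close>.\<close>

lemma exists_approx_of_larger_exponent: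
  fixes \<nu> :: real
  assumes seq: "best_approx_seq n \<zeta> P" and inf: "infinite {k. consec_lin_indep n P k}"
    and unif: "uniformly_approximable n \<zeta> \<nu>" and n: "n > 0" and \<nu>: "7 / 4 * real n < \<nu>"
  shows "\<exists>Q. Q \<noteq> 0 \<and> degree Q \<le> n \<and> height Q > B \<and>
    \<bar>ipoly Q \<zeta>\<bar> \<le> of_int (height Q) powr (- (\<nu> * (1 + 1 / real n)))"
proof (rule ccontr)
  assume neg: "\<not> ?thesis"
  define G where "G = 1 + 1 / real n"
  obtain k0 where k0: "\<And>k. k \<ge> k0 \<Longrightarrow> \<bar>ipoly (P k) \<zeta>\<bar> \<le> of_int (height (P (Suc k))) powr (- \<nu>)"
    using best_approx_seq_upper_bound[OF seq unif] by blast
  obtain B1 where B1: "B1 \<ge> 1" "\<And>x. x \<ge> B1 \<Longrightarrow> fact (n + 1) * x powr (7 / 4 * real n - \<nu>) < 1"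
    using powr_neg_eventually_small[of "7 / 4 * real n - \<nu>" "fact (n + 1)"] \<nu> by auto
  obtain k1 where k1: "\<And>k. k \<ge> k1 \<Longrightarrow> height (P k) > max B \<lceil>B1\<rceil>"
    using best_approx_seq_height_unbounded[OF seq] by blast
  obtain k where k: "k \<ge> max k0 k1" "consec_lin_indep n P k"
    using inf unfolding infinite_nat_iff_unbounded_le by blast
  \<comment> \<open>The shift by one matters: \<open>h 0\<close> is the height of
    \<open>P (k + 1)\<close>, which governs the value of \<open>P k\<close>.\<close>
  define h where "h i = real_of_int (height (P (k + Suc i)))" for i
  have hB: "h i \<ge> B1" for i
    using k1[of "k + Suc i"] k(1) unfolding h_def by (simp add: ceiling_less_iff)
  then have h1: "h i \<ge> 1" for i using B1(1) order.trans by blast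
  \<comment> \<open>After a larger jump, the uniform bound would make \<open>P (k + Suc i)\<close>
    one of the polynomials excluded by \<open>neg\<close>.\<close>
  have step: "h (Suc i) \<le> h i powr G" for i
  proof (rule ccontr)
    assume "\<not> h (Suc i) \<le> h i powr G"
    then have gt: "h i powr G < h (Suc i)" by simp
    let ?Q = "P (k + Suc i)"
    have "\<bar>ipoly ?Q \<zeta>\<bar> \<le> h (Suc i) powr (- \<nu>)"
      using k0[of "k + Suc i"] k(1) by (simp add: h_def)
    also have "\<dots> \<le> (h i powr G) powr (- \<nu>)"
      using gt \<nu> h1[of i] by (intro powr_mono2') auto
    also have "\<dots> = h i powr (- (\<nu> * G))" by (simp add: powr_powr mult.commute)
    finally have "\<bar>ipoly ?Q \<zeta>\<bar> \<le> of_int (height ?Q) powr (- (\<nu> * G))" by (simp add: h_def)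
    moreover have "best_approx n \<zeta> ?Q" using seq by (simp add: best_approx_seq_def)
    moreover have "height ?Q > B" using k1[of "k + Suc i"] k(1) by simp
    ultimately show False using neg unfolding G_def best_approx_def by blast
  qed
  have pow: "h i \<le> h 0 powr (G ^ i)" for i
  proof (induction i)
    case (Suc i)
    have "h (Suc i) \<le> h i powr G" by (rule step)
    also have "\<dots> \<le> (h 0 powr (G ^ i)) powr G"
      using Suc h1[of i] by (intro powr_mono2) (auto simp: G_def)
    finally show ?case by (simp add: powr_powr mult.commute)
  qed (use h1[of 0] in simp)
  have "1 \<le> fact (n + 1) * (\<bar>ipoly (P k) \<zeta>\<bar> * (\<Prod>i<n. h i))"
    using consec_lin_indep_height_bound[OF seq k(2)] by (simp add: h_def)
  also have "\<dots> \<le> fact (n + 1) * (h 0 powr (- \<nu>) * h 0 powr (7 / 4 * real n))"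
  proof (intro mult_left_mono mult_mono)
    show "\<bar>ipoly (P k) \<zeta>\<bar> \<le> h 0 powr (- \<nu>)" using k0[of k] k(1) by (simp add: h_def)
    have "(\<Prod>i<n. h i) \<le> (\<Prod>i<n. h 0 powr (G ^ i))"
      using pow h1 by (intro prod_mono) (auto intro: order.trans[of 0 1])
    also have "\<dots> = h 0 powr (\<Sum>i<n. G ^ i)"
      using h1[of 0] by (intro powr_sum[symmetric]) auto
    also have "\<dots> \<le> h 0 powr (7 / 4 * real n)"
      using h1[of 0] sum_powers_one_plus_inverse_le[OF n] by (intro powr_mono) (auto simp: G_def)
    finally show "(\<Prod>i<n. h i) \<le> h 0 powr (7 / 4 * real n)" .
    show "0 \<le> (\<Prod>i<n. h i)" using h1 by (intro prod_nonneg) (auto intro: order.trans[of 0 1])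
  qed auto
  also have "\<dots> = fact (n + 1) * h 0 powr (7 / 4 * real n - \<nu>)"
    by (simp flip: powr_add)
  also have "\<dots> < 1" by (rule B1(2)[OF hB])
  finally show False by simp
qed

text \<open>Otherwise irreducible polynomials of height above \<open>B\<close> satisfy a lower bound
  with exponent \<open>e\<close> and constant 1, and the finitely many others with some constant.
  The bound then extends to all polynomials, contradicting approximation with exponent
  \<open>w > e\<close>.\<close>

lemma exists_prime_elem_approx:
  fixes w :: real
  assumes \<zeta>: "\<not> algebraic \<zeta>" and w: "real e < w"
    and ap: "\<And>B. \<exists>P. P \<noteq> 0 \<and> degree P \<le> n \<and> height P > B \<and> \<bar>ipoly P \<zeta>\<bar> \<le> of_int (height P) powr (- w)"
  shows "\<exists>Q. prime_elem Q \<and> degree Q \<le> n \<and> height Q > B \<and> \<bar>ipoly Q \<zeta>\<bar> * of_int (height Q) ^ e \<le> 1"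
proof (rule ccontr)
  assume neg: "\<not> ?thesis"
  define F where "F = {Q. degree Q \<le> n \<and> height Q \<le> B}"
  define K where "K = 1 + (\<Sum>Q\<in>F. 1 / \<bar>ipoly Q \<zeta>\<bar>)"
  have sum0: "(\<Sum>Q\<in>F. 1 / \<bar>ipoly Q \<zeta>\<bar>) \<ge> 0" by (intro sum_nonneg) simp
  have "1 \<le> K * \<bar>ipoly Q \<zeta>\<bar> * of_int (height Q) ^ e" if Q: "prime_elem Q" "degree Q \<le> n" for Q
  proof -
    have Q0: "Q \<noteq> 0" using Q(1) by auto
    have h: "1 \<le> real_of_int (height Q) ^ e" using height_ge_1[OF Q0] by (intro one_le_power) simp
    show ?thesis
    proof (cases "Q \<in> F")
      case True
      have pos: "\<bar>ipoly Q \<zeta>\<bar> > 0" using ipoly_eq_0_iff[OF \<zeta>] Q0 by simp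
      have "1 / \<bar>ipoly Q \<zeta>\<bar> \<le> (\<Sum>Q\<in>F. 1 / \<bar>ipoly Q \<zeta>\<bar>)"
        using True finite_bounded_height[of n B] unfolding F_def by (intro member_le_sum) auto
      then have "1 / \<bar>ipoly Q \<zeta>\<bar> \<le> K" by (simp add: K_def)
      then have "1 \<le> K * \<bar>ipoly Q \<zeta>\<bar>" using pos by (simp add: field_simps)
      then show ?thesis using h mult_mono[of 1 "K * \<bar>ipoly Q \<zeta>\<bar>" 1 "of_int (height Q) ^ e"] by simp
    next
      case False
      then have "1 < \<bar>ipoly Q \<zeta>\<bar> * of_int (height Q) ^ e"
        using neg Q unfolding F_def by (auto simp: not_le)
      moreover have "1 \<le> K" using sum0 by (simp add: K_def)
      ultimately show ?thesis
        using mult_mono[of 1 K 1 "\<bar>ipoly Q \<zeta>\<bar> * of_int (height Q) ^ e"] by (simp add: mult.assoc)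
    qed
  qed
  then obtain K' where K': "\<And>P. P \<noteq> 0 \<Longrightarrow> degree P \<le> n \<Longrightarrow> 1 \<le> K' * \<bar>ipoly P \<zeta>\<bar> * of_int (height P) ^ e"
    using ipoly_lower_bound_of_prime_elem[of n K \<zeta> e n] by blast
  obtain B1 where B1: "B1 \<ge> 1" "\<And>x. x \<ge> B1 \<Longrightarrow> \<bar>K'\<bar> * x powr (real e - w) < 1"
    using powr_neg_eventually_small[of "real e - w" "\<bar>K'\<bar>"] w by auto
  obtain P where P: "P \<noteq> 0" "degree P \<le> n" "height P > \<lceil>B1\<rceil>" "\<bar>ipoly P \<zeta>\<bar> \<le> of_int (height P) powr (- w)"
    using ap by blast
  let ?x = "real_of_int (height P)"
  have x: "?x \<ge> B1" using P(3) by linarith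
  have "1 \<le> K' * \<bar>ipoly P \<zeta>\<bar> * ?x ^ e" by (rule K'[OF P(1,2)])
  also have "\<dots> \<le> \<bar>K'\<bar> * ?x powr (- w) * ?x ^ e"
    using P(4) height_nonneg[of P] by (intro mult_right_mono mult_mono) auto
  also have "\<dots> = \<bar>K'\<bar> * ?x powr (real e - w)"
    using x B1(1) by (simp add: powr_realpow[symmetric] mult.assoc flip: powr_add)
  also have "\<dots> < 1" by (rule B1(2)[OF x])
  finally show False by simp
qed

text \<open>Below the height of \<open>Q\<close> (up to a constant) no polynomial is divisible by \<open>Q\<close>, so the
  resultant bound applies to all uniform approximations of that size.\<close>

lemma not_uniformly_approximable_low_degree:
  fixes \<nu> :: real
  assumes unif: "uniformly_approximable n \<zeta> \<nu>" and \<nu>: "2 * real n - 2 < \<nu>" and m: "0 < m" "m < n"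
    and Q: "\<And>B. \<exists>Q. prime_elem Q \<and> degree Q = m \<and> height Q > B \<and> \<bar>ipoly Q \<zeta>\<bar> * of_int (height Q) ^ (2 * n) \<le> 1"
  shows False
proof -
  obtain X0 where X0: "X0 > 0" "\<And>X. X \<ge> X0 \<Longrightarrow> \<exists>P. P \<noteq> 0 \<and> degree P \<le> n \<and>
    of_int (height P) \<le> X \<and> \<bar>ipoly P \<zeta>\<bar> \<le> X powr (- \<nu>)"
    using uniformly_approximable_eventually[OF unif] by blast
  obtain C where C: "C \<ge> 1" "\<And>P Q. degree P \<le> n \<Longrightarrow> degree Q \<le> n \<Longrightarrow> height P * height Q \<le> C * height (P * Q)"
    using height_mult_ge[of n] by auto
  define c where "c = fact (n + m) * (max 1 \<bar>\<zeta>\<bar>) ^ (n + m)"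
  define c2 where "c2 = (2 * real_of_int C) powr \<nu>"
  \<comment> \<open>The two arguments are the exponents of \<open>H\<close> in the two terms of the
    resultant bound.\<close>
  define a where "a = max (- 1) (2 * real n - 2 - \<nu>)"
  have a: "a < 0" using \<nu> by (simp add: a_def)
  obtain B1 where B1: "B1 \<ge> 1" "\<And>x. x \<ge> B1 \<Longrightarrow> c * (1 + c2) * x powr a < 1"
    using powr_neg_eventually_small[OF a] by blast
  obtain Q where Q: "prime_elem Q" "degree Q = m" "height Q > \<lceil>max B1 (2 * real_of_int C * X0)\<rceil>"
    and Qs: "\<bar>ipoly Q \<zeta>\<bar> * of_int (height Q) ^ (2 * n) \<le> 1"
    using Q by blast
  define H where "H = real_of_int (height Q)"
  have H: "H \<ge> B1" "H \<ge> 2 * real_of_int C * X0" "H \<ge> 1"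
    using Q(3) B1(1) unfolding H_def by linarith+
  \<comment> \<open>A nonzero multiple of \<open>Q\<close> has height at least \<open>H / C\<close>;
    the factor 2 makes \<open>X\<close> strictly smaller.\<close>
  define X where "X = H / (2 * real_of_int C)"
  have C1: "real_of_int C \<ge> 1" using C(1) by simp
  have X: "X \<ge> X0" "X \<le> H" "X > 0" using H C1 by (auto simp: X_def field_simps mult_le_cancel_left1)
  obtain R where R: "R \<noteq> 0" "degree R \<le> n" "of_int (height R) \<le> X" "\<bar>ipoly R \<zeta>\<bar> \<le> X powr (- \<nu>)"
    using X0(2)[OF X(1)] by blast
  have "\<not> Q dvd R"
  proof
    assume "Q dvd R"
    then obtain S where S: "R = Q * S" by (rule dvdE)
    have S0: "S \<noteq> 0" "Q \<noteq> 0" using R(1) S by auto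
    have "degree S \<le> n" using R(2) S S0 by (simp add: degree_mult_eq)
    have "height Q * 1 \<le> height Q * height S"
      using height_ge_1[OF S0(1)] height_nonneg[of Q] by (intro mult_left_mono) auto
    also have "\<dots> \<le> C * height R" using C(2)[of Q S] Q(2) m \<open>degree S \<le> n\<close> S by simp
    finally have "H \<le> real_of_int C * of_int (height R)" unfolding H_def by (simp flip: of_int_mult)
    also have "\<dots> \<le> real_of_int C * X" using R(3) C1 by (intro mult_left_mono) auto
    also have "\<dots> = H / 2" using C1 by (simp add: X_def)
    finally show False using H(3) by simp
  qed
  then have "1 \<le> c * (\<bar>ipoly Q \<zeta>\<bar> * H ^ (n - 1) * of_int (height R) ^ m
      + \<bar>ipoly R \<zeta>\<bar> * H ^ n * of_int (height R) ^ (m - 1))"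
    using resultant_height_bound[OF Q(1,2) m(1) _ R(2), of \<zeta>] m unfolding c_def H_def by simp
  also have "\<dots> \<le> c * (H powr a + c2 * H powr a)"
  proof (intro mult_left_mono add_mono)
    have r: "real_of_int (height R) \<le> H" "0 \<le> real_of_int (height R)" using R(3) X(2) height_nonneg[of R] by auto
    have rm: "real_of_int (height R) ^ i \<le> H ^ j" if "i \<le> j" for i j
      using power_mono[OF r, of i] power_increasing[OF that H(3)] by linarith
    have "\<bar>ipoly Q \<zeta>\<bar> * H ^ (n - 1) * of_int (height R) ^ m \<le> \<bar>ipoly Q \<zeta>\<bar> * H ^ (n - 1) * H ^ n"
      using rm[of m n] m H(3) by (intro mult_left_mono) auto
    also have "\<dots> = \<bar>ipoly Q \<zeta>\<bar> * H ^ (2 * n) / H"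
      using m H(3) by (simp add: mult_2 power_add power_diff)
    also have "\<dots> \<le> 1 / H" using Qs H(3) unfolding H_def by (intro divide_right_mono) auto
    also have "\<dots> = H powr (- 1)" using H(3) by (simp add: powr_minus_divide)
    also have "\<dots> \<le> H powr a" using H(3) by (intro powr_mono) (auto simp: a_def)
    finally show "\<bar>ipoly Q \<zeta>\<bar> * H ^ (n - 1) * of_int (height R) ^ m \<le> H powr a" .
    \<comment> \<open>Here \<open>m < n\<close> saves a power of the height:
      \<open>m - 1 \<le> n - 2\<close> leads to the negative exponent
      \<open>2 * n - 2 - \<nu>\<close>.\<close>
    have "\<bar>ipoly R \<zeta>\<bar> * H ^ n * of_int (height R) ^ (m - 1) \<le> X powr (- \<nu>) * H ^ n * H ^ (n - 2)"
      using R(4) rm[of "m - 1" "n - 2"] m H(3) r by (intro mult_mono) auto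
    also have "X powr (- \<nu>) = c2 * H powr (- \<nu>)"
      using H(3) C1 by (simp add: X_def c2_def powr_divide powr_minus_divide)
    also have "c2 * H powr (- \<nu>) * H ^ n * H ^ (n - 2) = c2 * (H powr (- \<nu>) * (H powr real n * H powr real (n - 2)))"
      using H(3) by (simp add: powr_realpow)
    also have "\<dots> = c2 * H powr (2 * real n - 2 - \<nu>)"
      using m by (simp add: of_nat_diff flip: powr_add)
    also have "\<dots> \<le> c2 * H powr a"
      using H(3) by (intro mult_left_mono powr_mono) (auto simp: a_def c2_def)
    finally show "\<bar>ipoly R \<zeta>\<bar> * H ^ n * of_int (height R) ^ (m - 1) \<le> c2 * H powr a" .
  qed (simp add: c_def)
  also have "\<dots> = c * (1 + c2) * H powr a" by (simp add: algebra_simps)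
  also have "\<dots> < 1" by (rule B1(2)[OF H(1)])
  finally show False by simp
qed

text \<open>A multiple of \<open>Q\<close> of degree at most \<open>n = degree Q\<close> is at least \<open>1 / Y = \<bar>Q(\<zeta>)\<bar>\<close> at
  \<open>\<zeta>\<close>. The height bound \<open>Y powr \<alpha>\<close> is chosen so that uniform approximations fall below this
  value while both terms of the resultant bound still tend to zero.\<close>

lemma not_uniformly_approximable_full_degree:
  assumes unif: "uniformly_approximable n \<zeta> (2 * real n - 7 / 4)" and \<zeta>: "\<not> algebraic \<zeta>" and n: "n \<ge> 10"
    and Q: "\<And>B. \<exists>Q. prime_elem Q \<and> degree Q = n \<and> height Q > B \<and> \<bar>ipoly Q \<zeta>\<bar> * of_int (height Q) ^ (2 * n) \<le> 1"
  shows False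
proof -
  define \<nu> where "\<nu> = 2 * real n - 7 / 4"
  \<comment> \<open>The constant 9/5 lies slightly above 7/4, which gives
    \<open>\<alpha> * \<nu> > 1\<close>, and stays close enough to it for \<open>e1 < 0\<close> at
    \<open>n \<ge> 10\<close>.\<close>
  define \<alpha> where "\<alpha> = 1 / (2 * real n - 9 / 5)"
  have \<alpha>0: "\<alpha> > 0" using n by (simp add: \<alpha>_def)
  have \<alpha>\<nu>: "\<alpha> * \<nu> > 1" using n by (simp add: \<alpha>_def \<nu>_def field_simps)
  have \<alpha>2n: "2 * real n * \<alpha> \<ge> 1" using n by (simp add: \<alpha>_def field_simps)
  \<comment> \<open>The exponents of \<open>Y\<close> in the two resultant terms, after bounding the
    height of \<open>Q\<close> by \<open>Y powr (1 / (2 * n))\<close> and that of \<open>R\<close>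
    by \<open>Y powr \<alpha>\<close>.\<close>
  define e1 where "e1 = - 1 + (real n - 1) / (2 * real n) + \<alpha> * real n"
  define e2 where "e2 = - (\<alpha> * \<nu>) + 1 / 2 + \<alpha> * (real n - 1)"
  have e1: "e1 < 0"
  proof -
    \<comment> \<open>Expanding reduces this to \<open>n > 9\<close>, which is where the threshold
      10 comes from.\<close>
    have "2 * real n * real n < (real n + 1) * (2 * real n - 9 / 5)"
      using n by (simp add: algebra_simps)
    then have "\<alpha> * real n < (real n + 1) / (2 * real n)"
      using n by (simp add: \<alpha>_def field_simps)
    also have "\<dots> = 1 - (real n - 1) / (2 * real n)" using n by (simp add: field_simps)
    finally show ?thesis by (simp add: e1_def)
  qed
  have e2: "e2 < 0"
  proof -
    have "1 / 2 < \<alpha> * (real n - 3 / 4)" using n by (simp add: \<alpha>_def field_simps)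
    then show ?thesis by (simp add: e2_def \<nu>_def algebra_simps)
  qed
  define c where "c = fact (n + n) * (max 1 \<bar>\<zeta>\<bar>) ^ (n + n)"
  define a where "a = max e1 e2"
  have a: "a < 0" using e1 e2 by (simp add: a_def)
  obtain B1 where B1: "B1 \<ge> 1" "\<And>x. x \<ge> B1 \<Longrightarrow> c * 2 * x powr a < 1"
    using powr_neg_eventually_small[OF a] by blast
  obtain X0 where X0: "X0 > 0" "\<And>X. X \<ge> X0 \<Longrightarrow> \<exists>P. P \<noteq> 0 \<and> degree P \<le> n \<and>
    of_int (height P) \<le> X \<and> \<bar>ipoly P \<zeta>\<bar> \<le> X powr (- \<nu>)"
    using uniformly_approximable_eventually[OF unif] unfolding \<nu>_def by blast
  obtain Q where Q: "prime_elem Q" "degree Q = n" "height Q > \<lceil>max B1 X0\<rceil>"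
    and Qs: "\<bar>ipoly Q \<zeta>\<bar> * of_int (height Q) ^ (2 * n) \<le> 1"
    using Q by blast
  define H where "H = real_of_int (height Q)"
  have H: "H \<ge> B1" "H \<ge> X0" "H > 1"
    using Q(3) B1(1) unfolding H_def by linarith+
  have "Q \<noteq> 0" using Q(1) by auto
  define Y where "Y = 1 / \<bar>ipoly Q \<zeta>\<bar>"
  have Q\<zeta>: "\<bar>ipoly Q \<zeta>\<bar> > 0" using ipoly_eq_0_iff[OF \<zeta>] \<open>Q \<noteq> 0\<close> by simp
  have YH: "H powr (2 * real n) \<le> Y"
    using Qs Q\<zeta> H(3) powr_realpow[of H "2 * n"] by (simp add: Y_def H_def field_simps)
  have "H = H powr 1" using H(3) by simp
  also have "\<dots> \<le> H powr (2 * real n)" using H(3) n by (intro powr_mono) auto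
  finally have YH': "H \<le> Y" using YH by simp
  have HY: "H \<le> Y powr (1 / (2 * real n))"
  proof -
    have "H = (H powr (2 * real n)) powr (1 / (2 * real n))" using H(3) n by (simp add: powr_powr)
    also have "\<dots> \<le> Y powr (1 / (2 * real n))" using YH by (intro powr_mono2) auto
    finally show ?thesis .
  qed
  have Y1: "Y > 1" using YH' H(3) by simp
  define X where "X = Y powr \<alpha>"
  have "H = H powr 1" using H(3) by simp
  also have "\<dots> \<le> H powr (2 * real n * \<alpha>)" using H(3) \<alpha>2n by (intro powr_mono) auto
  also have "\<dots> = (H powr (2 * real n)) powr \<alpha>" by (simp add: powr_powr)
  also have "\<dots> \<le> X" unfolding X_def using YH \<alpha>0 by (intro powr_mono2) auto
  finally have "X \<ge> X0" using H(2) by simp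
  from X0(2)[OF this] obtain R where R: "R \<noteq> 0" "degree R \<le> n" "of_int (height R) \<le> X" "\<bar>ipoly R \<zeta>\<bar> \<le> X powr (- \<nu>)"
    by blast
  have R\<zeta>: "\<bar>ipoly R \<zeta>\<bar> \<le> Y powr (- (\<alpha> * \<nu>))" using R(4) by (simp add: X_def powr_powr)
  have "\<not> Q dvd R"
  proof
    assume "Q dvd R"
    then obtain S where S: "R = Q * S" by (rule dvdE)
    have S0: "S \<noteq> 0" using R(1) S by auto
    have "degree S = 0" using R(2) S S0 \<open>Q \<noteq> 0\<close> Q(2) by (simp add: degree_mult_eq)
    then obtain s where s: "S = [:s:]" by (rule degree_eq_zeroE)
    with S0 have "1 \<le> \<bar>real_of_int s\<bar>" by auto
    then have "\<bar>ipoly Q \<zeta>\<bar> * 1 \<le> \<bar>ipoly Q \<zeta>\<bar> * \<bar>real_of_int s\<bar>" by (intro mult_left_mono) auto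
    also have "\<dots> = \<bar>ipoly R \<zeta>\<bar>" unfolding S s ipoly_mult by (simp add: abs_mult)
    also have "\<dots> \<le> Y powr (- (\<alpha> * \<nu>))" by (rule R\<zeta>)
    also have "\<dots> < Y powr (- 1)" using Y1 \<alpha>\<nu> by (intro powr_less_mono) auto
    also have "\<dots> = \<bar>ipoly Q \<zeta>\<bar>" using Y1 by (simp add: powr_minus_divide Y_def)
    finally show False by simp
  qed
  then have "1 \<le> c * (\<bar>ipoly Q \<zeta>\<bar> * H ^ (n - 1) * of_int (height R) ^ n
      + \<bar>ipoly R \<zeta>\<bar> * H ^ n * of_int (height R) ^ (n - 1))"
    using resultant_height_bound[OF Q(1,2) _ _ R(2), of \<zeta>] n unfolding c_def H_def by simp
  also have "\<dots> \<le> c * (Y powr a + Y powr a)"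
  proof (intro mult_left_mono add_mono)
    have Hp: "H ^ i \<le> Y powr (real i / (2 * real n))" for i
    proof -
      have "H ^ i \<le> (Y powr (1 / (2 * real n))) ^ i" using HY H(3) by (intro power_mono) auto
      also have "\<dots> = Y powr (real i / (2 * real n))"
        using Y1 by (subst powr_realpow[symmetric]) (auto simp: powr_powr)
      finally show ?thesis .
    qed
    have Rp: "of_int (height R) ^ i \<le> Y powr (\<alpha> * real i)" for i
    proof -
      have "of_int (height R) ^ i \<le> X ^ i" using R(3) height_nonneg[of R] by (intro power_mono) auto
      also have "\<dots> = Y powr (\<alpha> * real i)"
        using Y1 unfolding X_def by (subst powr_realpow[symmetric]) (auto simp: powr_powr)
      finally show ?thesis .
    qed
    have "\<bar>ipoly Q \<zeta>\<bar> = Y powr (- 1)" using Y1 by (simp add: powr_minus_divide Y_def)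
    then have "\<bar>ipoly Q \<zeta>\<bar> * H ^ (n - 1) * of_int (height R) ^ n
        \<le> Y powr (- 1) * Y powr (real (n - 1) / (2 * real n)) * Y powr (\<alpha> * real n)"
      using Hp[of "n - 1"] Rp[of n] H(3) height_nonneg[of R] by (intro mult_mono) auto
    also have "\<dots> = Y powr e1"
      unfolding powr_add[symmetric] e1_def using n by (simp add: of_nat_diff)
    also have "\<dots> \<le> Y powr a" using Y1 by (intro powr_mono) (auto simp: a_def)
    finally show "\<bar>ipoly Q \<zeta>\<bar> * H ^ (n - 1) * of_int (height R) ^ n \<le> Y powr a" .
    have "\<bar>ipoly R \<zeta>\<bar> * H ^ n * of_int (height R) ^ (n - 1)
        \<le> Y powr (- (\<alpha> * \<nu>)) * Y powr (real n / (2 * real n)) * Y powr (\<alpha> * real (n - 1))"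
      using R\<zeta> Hp[of n] Rp[of "n - 1"] H(3) height_nonneg[of R] by (intro mult_mono) auto
    also have "\<dots> = Y powr e2"
      unfolding powr_add[symmetric] e2_def using n by (simp add: of_nat_diff)
    also have "\<dots> \<le> Y powr a" using Y1 by (intro powr_mono) (auto simp: a_def)
    finally show "\<bar>ipoly R \<zeta>\<bar> * H ^ n * of_int (height R) ^ (n - 1) \<le> Y powr a" .
  qed (simp add: c_def)
  also have "\<dots> = c * 2 * Y powr a" by simp
  also have "\<dots> < 1" using YH' H(1) by (intro B1(2)) simp
  finally show False by simp
qed

text \<open>Irreducible approximations exist at unbounded heights. Some degree \<open>m\<close> must
  recur among them, and the cases \<open>m < n\<close> and \<open>m = n\<close> are refuted
  separately.\<close>

lemma not_uniformly_approximable: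
  assumes \<zeta>: "\<not> algebraic \<zeta>" and n: "n \<ge> 10"
    and indep: "\<And>P. best_approx_seq n \<zeta> P \<Longrightarrow> infinite {k. consec_lin_indep n P k}"
  shows "\<not> uniformly_approximable n \<zeta> (2 * real n - 7 / 4)"
proof
  define \<nu> where "\<nu> = 2 * real n - 7 / 4"
  assume "uniformly_approximable n \<zeta> (2 * real n - 7 / 4)"
  then have unif: "uniformly_approximable n \<zeta> \<nu>" by (simp add: \<nu>_def)
  have \<nu>: "\<nu> > 7 / 4 * real n" "2 * real n - 2 < \<nu>" "\<nu> > 0" using n by (simp_all add: \<nu>_def)
  obtain X0 where X0: "X0 > 0" "\<And>X. X \<ge> X0 \<Longrightarrow> \<exists>P. P \<noteq> 0 \<and> degree P \<le> n \<and>
    of_int (height P) \<le> X \<and> \<bar>ipoly P \<zeta>\<bar> \<le> X powr (- \<nu>)"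
    using uniformly_approximable_eventually[OF unif] by blast
  \<comment> \<open>Arbitrarily small values guarantee that a sequence of best approximations
    exists, so that \<open>indep\<close> can be applied.\<close>
  have "\<exists>Q. Q \<noteq> 0 \<and> degree Q \<le> n \<and> \<bar>ipoly Q \<zeta>\<bar> < \<delta>" if "\<delta> > 0" for \<delta>
  proof -
    obtain B1 where B1: "B1 \<ge> 1" "\<And>x. x \<ge> B1 \<Longrightarrow> 1 / \<delta> * x powr (- \<nu>) < 1"
      using powr_neg_eventually_small[of "- \<nu>" "1 / \<delta>"] \<nu>(3) by auto
    let ?X = "max X0 B1"
    have "1 / \<delta> * ?X powr (- \<nu>) < 1" by (rule B1(2)) simp
    then have "?X powr (- \<nu>) < \<delta>" using that by (simp add: field_simps)
    with X0(2)[of ?X] show ?thesis by force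
  qed
  then obtain P where seq: "best_approx_seq n \<zeta> P" using best_approx_seq_exists[OF \<zeta>] by blast
  have "\<exists>Q. prime_elem Q \<and> degree Q \<le> n \<and> height Q > B \<and> \<bar>ipoly Q \<zeta>\<bar> * of_int (height Q) ^ (2 * n) \<le> 1" for B
  proof (rule exists_prime_elem_approx[OF \<zeta>])
    \<comment> \<open>The right-hand side is \<open>2 * n + 1 / 4 - 7 / (4 * n)\<close>, above
      \<open>2 * n\<close> as soon as \<open>n > 7\<close>.\<close>
    show "real (2 * n) < \<nu> * (1 + 1 / real n)" using n by (simp add: \<nu>_def field_simps)
    show "\<exists>P. P \<noteq> 0 \<and> degree P \<le> n \<and> height P > B \<and>
        \<bar>ipoly P \<zeta>\<bar> \<le> of_int (height P) powr (- (\<nu> * (1 + 1 / real n)))" for B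
      using exists_approx_of_larger_exponent[OF seq indep[OF seq] unif _ \<nu>(1)] n by simp
  qed
  then obtain q where q: "\<And>B. prime_elem (q B) \<and> degree (q B) \<le> n \<and> height (q B) > B \<and>
      \<bar>ipoly (q B) \<zeta>\<bar> * of_int (height (q B)) ^ (2 * n) \<le> 1"
    by metis
  \<comment> \<open>Pigeonhole: if every degree had its own height bound \<open>b m\<close>, their
    maximum would bound all heights.\<close>
  have "\<exists>m\<le>n. \<forall>B. \<exists>Q. prime_elem Q \<and> degree Q = m \<and> height Q > B \<and> \<bar>ipoly Q \<zeta>\<bar> * of_int (height Q) ^ (2 * n) \<le> 1"
  proof (rule ccontr)
    assume "\<not> ?thesis"
    then obtain b where b: "\<And>m Q. m \<le> n \<Longrightarrow> prime_elem Q \<Longrightarrow> degree Q = m \<Longrightarrow> height Q > b m \<Longrightarrow>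
        \<not> \<bar>ipoly Q \<zeta>\<bar> * of_int (height Q) ^ (2 * n) \<le> 1"
      by metis
    define B where "B = Max (b ` {..n})"
    have "b m \<le> B" if "m \<le> n" for m unfolding B_def using that by (intro Max_ge) auto
    then have "b (degree (q B)) \<le> B" using q[of B] by blast
    then show False using b[of "degree (q B)" "q B"] q[of B] by auto
  qed
  then obtain m where m: "m \<le> n" and Q: "\<And>B. \<exists>Q. prime_elem Q \<and> degree Q = m \<and> height Q > B \<and>
      \<bar>ipoly Q \<zeta>\<bar> * of_int (height Q) ^ (2 * n) \<le> 1"
    by blast
  have "m > 0"
  proof (rule ccontr)
    assume "\<not> m > 0"
    with Q[of 1] obtain Q where "degree Q = 0" and h: "height Q > 1" "\<bar>ipoly Q \<zeta>\<bar> * of_int (height Q) ^ (2 * n) \<le> 1"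
      by auto
    then obtain s where s: "Q = [:s:]" using degree_eq_zeroE by blast
    \<comment> \<open>A constant has value equal to its height up to sign, so it cannot be a good
      approximation.\<close>
    have "1 < \<bar>real_of_int s\<bar> * \<bar>real_of_int s\<bar> ^ (2 * n)"
      using h(1) s by (intro less_1_mult one_less_power) (use n in auto)
    with h(2) s show False by simp
  qed
  show False
  proof (cases "m < n")
    case True
    show False by (rule not_uniformly_approximable_low_degree[OF unif \<nu>(2) \<open>m > 0\<close> True Q])
  next
    case False
    with m have "m = n" by simp
    show False
      by (rule not_uniformly_approximable_full_degree[OF unif[unfolded \<nu>_def] \<zeta> n Q[unfolded \<open>m = n\<close>]])
  qed
qed

theorem theorem4p2:
  assumes "\<forall>n::nat. n \<ge> 1 \<longrightarrow> (\<forall>\<zeta>::real. \<not> algebraic \<zeta> \<longrightarrow>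
             (\<forall>P. best_approx_seq n \<zeta> P \<longrightarrow> infinite {k. consec_lin_indep n P k}))"
  shows "\<forall>\<epsilon>::real. \<epsilon> > 0 \<longrightarrow> (\<exists>n0::nat. \<forall>\<zeta>::real. \<forall>n. n \<ge> n0 \<longrightarrow> \<not> algebraic \<zeta> \<longrightarrow>
           hat_w n \<zeta> \<le> ereal (2 * real n - 1 - ln 2 + \<epsilon>))"
proof (intro allI impI exI[of _ 10])
  fix \<epsilon> \<zeta> :: real and n :: nat
  assume \<epsilon>: "\<epsilon> > 0" and n: "10 \<le> n" and \<zeta>: "\<not> algebraic \<zeta>"
  have "ln 2 \<le> (3 / 4 :: real)"
  proof -
    \<comment> \<open>The quadratic Taylor polynomial of \<open>exp\<close> at 3/4 equals 65/32,
      just above 2.\<close>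
    have "2 \<le> 1 + 3 / 4 + (3 / 4)\<^sup>2 / (2 :: real)" by (simp add: power2_eq_square)
    also have "\<dots> \<le> exp (3 / 4)" by (rule exp_lower_Taylor_quadratic) simp
    finally have "ln 2 \<le> ln (exp (3 / 4 :: real))" by (subst ln_le_cancel_iff) auto
    then show ?thesis by simp
  qed
  show "hat_w n \<zeta> \<le> ereal (2 * real n - 1 - ln 2 + \<epsilon>)"
    unfolding hat_w_def
  proof (rule Sup_least, clarify)
    fix \<nu> :: real
    assume "\<forall>\<^sub>F X :: real in at_top. \<exists>P :: int poly. P \<noteq> 0 \<and> degree P \<le> n \<and>
      real_of_int (height P) \<le> X \<and> \<bar>ipoly P \<zeta>\<bar> \<le> X powr (- \<nu>)"
    then have "uniformly_approximable n \<zeta> \<nu>" unfolding uniformly_approximable_def .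
    moreover have "\<not> uniformly_approximable n \<zeta> (2 * real n - 7 / 4)"
      using assms n \<zeta> by (intro not_uniformly_approximable) auto
    ultimately have "\<nu> < 2 * real n - 7 / 4"
      using uniformly_approximable_mono by (meson not_le)
    then show "ereal \<nu> \<le> ereal (2 * real n - 1 - ln 2 + \<epsilon>)"
      using \<open>ln 2 \<le> 3 / 4\<close> \<epsilon> by simp
  qed
qed

end
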